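(* Let $X$ be a separable Banach space with the bounded approximation property. The space $X$ does not have the TPBA if and only if there exists a Banach space $Z$ such that $X$ is a subspace of $Z$ and the following conditions are satisfied: (a) $X^\perp$ is uncomplemented in $Z^*$; (b) $X^*$ contains a norming subspace $M$ which is boundedly extendeable onto $Z$.
   Context: For a subspace $X$ of a Banach space $Z$, $X^\perp=\{z^*\in Z^*: z^*(x)=0\ \forall x\in X\}$. A subspace $M\subset X^*$ is norming if there exists $c>0$ such that $\sup_{0\ne f\in M}|f(x)|/\|f\|\ge c\|x\|$ for all $x\in X$. A subspace $M\subset X^*$ is quasibasic if there exists a sequence of continuous finite-dimensional (i.e. finite-rank) linear operators $v_n:X\to X$ such that $\lim_{n\to\infty}\|v_n(x)-x\|=0$ for all $x\in X$, and $\mathrm{im}(v_n^* )\subset M$ for all $n$, where $v_n^*$ is the adjoint of $v_n$. A Banach space $X$ has the total property of bounded approximation (TPBA) if every norming subspace $M$ of $X^*$ is quasibasic. Let $X$ be a subspace of a Banach space $Z$ and let $M$ be a subspace of $X^*$. The subspace $M$ is boundedly extendeable onto $Z$ if there exists an isomorphic embedding $\pi:M\to Z^*$ such that $(\pi(f))(x)=f(x)$ for all $f\in M$ and all $x\in X$. *)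

theory Defs
  imports "HOL-Analysis.Analysis" "HOL-Library.FuncSet"
begin

text \<open>
  The space \<open>X\<close> is a type of class \<^class>\<open>banach\<close> (real scalars), with dual
  \<open>'a \<Rightarrow>\<^sub>L real\<close>. The space \<open>Z\<close> is existentially quantified, so it has to be a value rather
  than a type: a carrier set with its own operations and norm. Nothing is required of the
  operations outside the carrier.
\<close>

record 'z nspace =
  carr :: "'z set"
  vadd :: "'z \<Rightarrow> 'z \<Rightarrow> 'z"
  vzero :: "'z"
  vscale :: "real \<Rightarrow> 'z \<Rightarrow> 'z"
  vnorm :: "'z \<Rightarrow> real"

definition vdist :: "'z nspace \<Rightarrow> 'z \<Rightarrow> 'z \<Rightarrow> real" where
  "vdist Z x y = vnorm Z (vadd Z x (vscale Z (-1) y))"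

locale normed_nspace =
  fixes Z :: "'z nspace"
  assumes zero_in: "vzero Z \<in> carr Z"
    and add_in: "\<lbrakk>x \<in> carr Z; y \<in> carr Z\<rbrakk> \<Longrightarrow> vadd Z x y \<in> carr Z"
    and scale_in: "x \<in> carr Z \<Longrightarrow> vscale Z a x \<in> carr Z"
    and add_assoc: "\<lbrakk>x \<in> carr Z; y \<in> carr Z; z \<in> carr Z\<rbrakk>
          \<Longrightarrow> vadd Z (vadd Z x y) z = vadd Z x (vadd Z y z)"
    and add_commute: "\<lbrakk>x \<in> carr Z; y \<in> carr Z\<rbrakk> \<Longrightarrow> vadd Z x y = vadd Z y x"
    and add_zero: "x \<in> carr Z \<Longrightarrow> vadd Z x (vzero Z) = x"
    and add_inverse: "x \<in> carr Z \<Longrightarrow> vadd Z x (vscale Z (-1) x) = vzero Z"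
    and scale_one: "x \<in> carr Z \<Longrightarrow> vscale Z 1 x = x"
    and scale_scale: "x \<in> carr Z \<Longrightarrow> vscale Z a (vscale Z b x) = vscale Z (a * b) x"
    and scale_add_right: "\<lbrakk>x \<in> carr Z; y \<in> carr Z\<rbrakk>
          \<Longrightarrow> vscale Z a (vadd Z x y) = vadd Z (vscale Z a x) (vscale Z a y)"
    and scale_add_left: "x \<in> carr Z
          \<Longrightarrow> vscale Z (a + b) x = vadd Z (vscale Z a x) (vscale Z b x)"
    and norm_eq_zero: "x \<in> carr Z \<Longrightarrow> vnorm Z x = 0 \<longleftrightarrow> x = vzero Z"
    and norm_scale: "x \<in> carr Z \<Longrightarrow> vnorm Z (vscale Z a x) = \<bar>a\<bar> * vnorm Z x"
    and norm_triangle: "\<lbrakk>x \<in> carr Z; y \<in> carr Z\<rbrakk>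
          \<Longrightarrow> vnorm Z (vadd Z x y) \<le> vnorm Z x + vnorm Z y"

locale banach_nspace = normed_nspace +
  assumes complete:
    "\<lbrakk>\<And>n. s n \<in> carr Z; \<And>e. e > 0 \<Longrightarrow> \<exists>N. \<forall>m\<ge>N. \<forall>n\<ge>N. vdist Z (s m) (s n) < e\<rbrakk>
       \<Longrightarrow> \<exists>l\<in>carr Z. (\<lambda>n. vdist Z (s n) l) \<longlonglongrightarrow> 0"

definition nspace_of :: "'b::real_normed_vector set \<Rightarrow> 'b nspace" where
  "nspace_of S = \<lparr>carr = S, vadd = (+), vzero = 0, vscale = (*\<^sub>R), vnorm = norm\<rparr>"

lemma nspace_of_simps [simp]:
  "carr (nspace_of S) = S" "vadd (nspace_of S) = (+)" "vzero (nspace_of S) = 0"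
  "vscale (nspace_of S) = (*\<^sub>R)" "vnorm (nspace_of S) = norm" "vdist (nspace_of S) = dist"
  by (auto simp: nspace_of_def vdist_def dist_norm fun_eq_iff)

lemma normed_nspace_of:
  assumes "subspace S"
  shows "normed_nspace (nspace_of S)"
  by (rule normed_nspace.intro)
    (simp_all add: assms subspace_add subspace_scale subspace_0 scaleR_add_right
      scaleR_add_left norm_triangle_ineq add.commute add.left_commute)

lemma banach_nspace_of:
  fixes S :: "'b::banach set"
  assumes "subspace S" "closed S"
  shows "banach_nspace (nspace_of S)"
proof -
  interpret normed_nspace "nspace_of S"
    using assms(1) by (rule normed_nspace_of)
  show ?thesis
  proof unfold_locales
    fix s :: "nat \<Rightarrow> 'b"
    assume s: "\<And>n. s n \<in> carr (nspace_of S)"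
      and C: "\<And>e. e > 0 \<Longrightarrow> \<exists>N. \<forall>m\<ge>N. \<forall>n\<ge>N. vdist (nspace_of S) (s m) (s n) < e"
    have "Cauchy s"
      unfolding Cauchy_def using C by simp
    then obtain l where l: "s \<longlonglongrightarrow> l"
      using Cauchy_convergent convergent_def by metis
    have "l \<in> S"
      using closed_sequentially[OF assms(2) _ l] s by simp
    moreover have "(\<lambda>n. dist (s n) l) \<longlonglongrightarrow> 0"
      using l tendsto_dist_iff by metis
    ultimately show "\<exists>l\<in>carr (nspace_of S). (\<lambda>n. vdist (nspace_of S) (s n) l) \<longlonglongrightarrow> 0"
      by (intro bexI[of _ l]) simp_all
  qed
qed

definition bounded_linear_map :: "'y nspace \<Rightarrow> 'z nspace \<Rightarrow> ('y \<Rightarrow> 'z) \<Rightarrow> bool" where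
  "bounded_linear_map Y Z T \<longleftrightarrow>
     T \<in> carr Y \<rightarrow> carr Z \<and>
     (\<forall>x\<in>carr Y. \<forall>y\<in>carr Y. T (vadd Y x y) = vadd Z (T x) (T y)) \<and>
     (\<forall>a. \<forall>x\<in>carr Y. T (vscale Y a x) = vscale Z a (T x)) \<and>
     (\<exists>K. \<forall>x\<in>carr Y. vnorm Z (T x) \<le> K * vnorm Y x)"

definition isomorphic_embedding :: "'y nspace \<Rightarrow> 'z nspace \<Rightarrow> ('y \<Rightarrow> 'z) \<Rightarrow> bool" where
  "isomorphic_embedding Y Z T \<longleftrightarrow>
     bounded_linear_map Y Z T \<and> (\<exists>k>0. \<forall>x\<in>carr Y. k * vnorm Y x \<le> vnorm Z (T x))"

definition isometric_embedding :: "'y nspace \<Rightarrow> 'z nspace \<Rightarrow> ('y \<Rightarrow> 'z) \<Rightarrow> bool" where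
  "isometric_embedding Y Z T \<longleftrightarrow>
     bounded_linear_map Y Z T \<and> (\<forall>x\<in>carr Y. vnorm Z (T x) = vnorm Y x)"

text \<open>
  Functionals are taken \<^const>\<open>extensional\<close> (fixed to \<^const>\<open>undefined\<close> off the carrier), so
  that equality of functionals is equality on the carrier.
\<close>

definition dual_nspace :: "'z nspace \<Rightarrow> ('z \<Rightarrow> real) nspace" where
  "dual_nspace Z =
     \<lparr>carr = {\<phi> \<in> extensional (carr Z). bounded_linear_map Z (nspace_of UNIV) \<phi>},
      vadd = (\<lambda>\<phi> \<psi>. \<lambda>x\<in>carr Z. \<phi> x + \<psi> x),
      vzero = (\<lambda>x\<in>carr Z. 0),
      vscale = (\<lambda>a \<phi>. \<lambda>x\<in>carr Z. a * \<phi> x),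
      vnorm = (\<lambda>\<phi>. SUP x\<in>{x \<in> carr Z. vnorm Z x \<le> 1}. \<bar>\<phi> x\<bar>)\<rparr>"

definition complemented_in :: "'z set \<Rightarrow> 'z nspace \<Rightarrow> bool" where
  "complemented_in Y Z \<longleftrightarrow>
     (\<exists>P. bounded_linear_map Z Z P \<and> P ` carr Z = Y \<and> (\<forall>y\<in>Y. P y = y))"

definition annihilator :: "'z nspace \<Rightarrow> 'z set \<Rightarrow> ('z \<Rightarrow> real) set" where
  "annihilator Z S = {\<phi> \<in> carr (dual_nspace Z). \<forall>x\<in>S. \<phi> x = 0}"

definition finite_rank :: "('a::real_normed_vector \<Rightarrow>\<^sub>L 'b::real_normed_vector) \<Rightarrow> bool" where
  "finite_rank v \<longleftrightarrow> (\<exists>B. finite B \<and> range (blinfun_apply v) = span B)"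

definition BAP :: "'a::banach itself \<Rightarrow> bool" where
  "BAP (X :: 'a itself) \<longleftrightarrow>
     (\<exists>l. \<forall>K :: 'a set. \<forall>e>0. compact K \<longrightarrow>
        (\<exists>v :: 'a \<Rightarrow>\<^sub>L 'a. finite_rank v \<and> norm v \<le> l \<and> (\<forall>x\<in>K. norm (v x - x) < e)))"

definition blinfun_adjoint ::
  "('a::real_normed_vector \<Rightarrow>\<^sub>L 'b::real_normed_vector) \<Rightarrow> ('b \<Rightarrow>\<^sub>L real) \<Rightarrow> ('a \<Rightarrow>\<^sub>L real)" where
  "blinfun_adjoint v f = f o\<^sub>L v"

text \<open>
  The term \<open>f = 0\<close> contributes \<open>0 / 0 = 0\<close> to the supremum. Including it only fixes the
  supremum to be \<open>0\<close> when \<open>M = {0}\<close>.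
\<close>

definition norming :: "('a::banach \<Rightarrow>\<^sub>L real) set \<Rightarrow> bool" where
  "norming M \<longleftrightarrow> (\<exists>c>0. \<forall>x. (SUP f\<in>M. \<bar>blinfun_apply f x\<bar> / norm f) \<ge> c * norm x)"

definition quasibasic :: "('a::banach \<Rightarrow>\<^sub>L real) set \<Rightarrow> bool" where
  "quasibasic M \<longleftrightarrow>
     (\<exists>v :: nat \<Rightarrow> 'a \<Rightarrow>\<^sub>L 'a.
        (\<forall>n. finite_rank (v n)) \<and>
        (\<forall>x. (\<lambda>n. norm (v n x - x)) \<longlonglongrightarrow> 0) \<and>
        (\<forall>n. range (blinfun_adjoint (v n)) \<subseteq> M))"

definition TPBA :: "'a::banach itself \<Rightarrow> bool" where
  "TPBA (X :: 'a itself) \<longleftrightarrow>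
     (\<forall>M :: ('a \<Rightarrow>\<^sub>L real) set. subspace M \<and> norming M \<longrightarrow> quasibasic M)"

text \<open>Here \<open>J\<close> is the inclusion of \<open>X\<close> into \<open>Z\<close>.\<close>

definition boundedly_extendable ::
  "('a::banach \<Rightarrow>\<^sub>L real) set \<Rightarrow> 'z nspace \<Rightarrow> ('a \<Rightarrow> 'z) \<Rightarrow> bool" where
  "boundedly_extendable M Z J \<longleftrightarrow>
     (\<exists>\<pi>. isomorphic_embedding (nspace_of M) (dual_nspace Z) \<pi> \<and>
          (\<forall>f\<in>M. \<forall>x. \<pi> f (J x) = blinfun_apply f x))"

text \<open>
  HOL has no quantifier over types, so the Banach spaces \<open>Z\<close> range over the structures carried by
  subsets of a fixed type. For arbitrary \<open>'z\<close>, the type below contains a copy of \<open>'z\<close>, and hence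
  of every Banach space carried by a subset of \<open>'z\<close>: a theorem polymorphic in \<open>'z\<close> speaks about
  Banach spaces \<open>Z\<close> of every size. The second summand ensures that, however small \<open>'z\<close> is, the
  type has room for \<open>X\<close>, for its second dual, and for the duals of subspaces of \<open>X\<^sup>*\<close>.
\<close>

type_synonym ('a, 'z) univ = "'z + (('a \<Rightarrow>\<^sub>L real) \<Rightarrow> real)"

end

theory Submission
  imports Defs "HOL-Library.Function_Algebras"
begin

text \<open>
  Complementing \<open>X\<^sup>\<bottom>\<close> in \<open>Z\<^sup>*\<close> amounts to giving a bounded linear extension operator
  \<open>E : X\<^sup>* \<rightarrow> Z\<^sup>*\<close>: from \<open>E\<close> one gets the projection \<open>\<phi> \<mapsto> \<phi> - E (\<phi> restricted to X)\<close>, and from a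
  projection \<open>P\<close> the operator \<open>E f = F - P F\<close>, where \<open>F\<close> is any Hahn-Banach extension of \<open>f\<close>.

  If \<open>M\<close> is quasibasic through \<open>v\<^sub>n\<close> and extended to \<open>Z\<close> by \<open>\<pi>\<close>, then a Banach limit of
  \<open>\<pi> (v\<^sub>n\<^sup>* f)\<close> is such an \<open>E f\<close>. Conversely, for a norming \<open>M\<close> that is not quasibasic take
  \<open>Z = M\<^sup>*\<close>, renormed so that \<open>X\<close> embeds isometrically. An operator \<open>E : X\<^sup>* \<rightarrow> M\<^sup>*\<^sup>*\<close> would turn the
  finite-rank operators \<open>\<Sum> f\<^sub>b \<otimes> b\<close> of the bounded approximation property into \<open>\<Sum> E f\<^sub>b \<otimes> b\<close>,
  and local reflexivity would replace each \<open>E f\<^sub>b\<close> by an element of \<open>M\<close> without changing the values at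
  finitely many points of \<open>X\<close> by much, so that \<open>M\<close> would be quasibasic after all.
\<close>

section \<open>Sublinear functionals and the Hahn-Banach theorem\<close>

text \<open>The operators \<open>v n\<close> converge only pointwise on \<open>X\<close>, so their
  adjoints applied to \<open>f\<close> need not converge in norm. A Banach limit selects a weak-star
  cluster point linearly in \<open>f\<close>, and a projection needs that linearity.

  In the converse the obstacle is a norm bound. Replacing each \<open>E f_b\<close> separately would
  give operators whose norm depends on how \<open>v\<close> is written as a sum. But the norm of the
  new operator with coefficients \<open>m b\<close> in \<open>M\<close> is the supremum, over
  functionals \<open>g\<close> of norm at most 1, of the norms of the sums of \<open>g b\<close>
  times \<open>m b\<close>; before the replacement the corresponding sum is \<open>E\<close> applied
  to the composition of \<open>g\<close> with \<open>v\<close>, of norm at most that of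
  \<open>E\<close> times that of \<open>v\<close>. So local reflexivity has to keep the norms of
  many combinations at once. A finite net of functionals \<open>g\<close> makes this a finite system
  of inequalities, solved by one separation argument. The bound obtained is uniform in
  \<open>v\<close>, so that good approximation on the first points of a dense sequence yields
  pointwise convergence everywhere.\<close>

instantiation "fun" :: (type, real_vector) real_vector
begin

definition scaleR_fun_def: "r *\<^sub>R f = (\<lambda>x. r *\<^sub>R f x)"

instance
  by standard (simp_all add: scaleR_fun_def fun_eq_iff scaleR_add_right scaleR_add_left)

end

lemma scaleR_fun_apply [simp]: "(r *\<^sub>R f) x = r *\<^sub>R f x"
  by (simp add: scaleR_fun_def)

text \<open>Everything is relative to a subspace \<open>V\<close>: the bounded sequences and the
  functionals on \<open>M\<close> extended by 0 are subspaces of function types, which the instance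
  above turns into vector spaces.\<close>

definition sublinear_on :: "'v::real_vector set \<Rightarrow> ('v \<Rightarrow> real) \<Rightarrow> bool" where
  "sublinear_on V p \<longleftrightarrow>
     (\<forall>x\<in>V. \<forall>y\<in>V. p (x + y) \<le> p x + p y) \<and> (\<forall>r\<ge>0. \<forall>x\<in>V. p (r *\<^sub>R x) = r * p x)"

definition linear_on_subspace :: "'v::real_vector set \<Rightarrow> ('v \<Rightarrow> real) \<Rightarrow> bool" where
  "linear_on_subspace V L \<longleftrightarrow>
     (\<forall>x\<in>V. \<forall>y\<in>V. L (x + y) = L x + L y) \<and> (\<forall>r. \<forall>x\<in>V. L (r *\<^sub>R x) = r * L x)"

lemma sublinear_onD:
  assumes "sublinear_on V p"
  shows "x \<in> V \<Longrightarrow> y \<in> V \<Longrightarrow> p (x + y) \<le> p x + p y"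
    and "0 \<le> r \<Longrightarrow> x \<in> V \<Longrightarrow> p (r *\<^sub>R x) = r * p x"
  using assms by (auto simp: sublinear_on_def)

text \<open>One inequality for positive \<open>r\<close> suffices: applied to
  \<open>inverse r\<close> and \<open>r *\<^sub>R x\<close> it yields the other one.\<close>

lemma sublinear_onI:
  assumes V: "subspace V"
    and add: "\<And>x y. x \<in> V \<Longrightarrow> y \<in> V \<Longrightarrow> p (x + y) \<le> p x + p y"
    and scale: "\<And>x r. 0 < r \<Longrightarrow> x \<in> V \<Longrightarrow> p (r *\<^sub>R x) \<le> r * p x"
    and zero: "p 0 = 0"
  shows "sublinear_on V p"
  unfolding sublinear_on_def
proof (intro conjI ballI allI impI add)
  fix r :: real and x assume r: "0 \<le> r" and x: "x \<in> V"
  show "p (r *\<^sub>R x) = r * p x"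
  proof (cases "r = 0")
    case False
    then have "p (inverse r *\<^sub>R r *\<^sub>R x) \<le> inverse r * p (r *\<^sub>R x)"
      using r x V by (intro scale) (auto simp: subspace_scale)
    then have "r * p x \<le> p (r *\<^sub>R x)"
      using False r by (simp add: field_simps)
    then show ?thesis using scale[of r x] False r x by simp
  qed (simp add: zero)
qed

lemma linear_on_subspaceD:
  assumes "linear_on_subspace V L"
  shows "x \<in> V \<Longrightarrow> y \<in> V \<Longrightarrow> L (x + y) = L x + L y"
    and "x \<in> V \<Longrightarrow> L (r *\<^sub>R x) = r * L x"
  using assms by (auto simp: linear_on_subspace_def)

lemma sublinear_on_zero:
  assumes "sublinear_on V p" "subspace V"
  shows "p 0 = 0"
  using sublinear_onD(2)[OF assms(1), of 0 0] assms(2) by (simp add: subspace_0)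

lemma sublinear_on_minus:
  assumes "sublinear_on V p" "subspace V" "x \<in> V"
  shows "- p (- x) \<le> p x"
  using sublinear_onD(1)[OF assms(1), of x "- x"] sublinear_on_zero[OF assms(1,2)] assms(2,3)
  by (simp add: subspace_neg)

lemma linear_on_subspace_zero:
  assumes "linear_on_subspace V L" "subspace V"
  shows "L 0 = 0"
  using linear_on_subspaceD(2)[OF assms(1), of 0 0] assms(2) by (simp add: subspace_0)

lemma linear_on_subspace_sum:
  assumes "linear_on_subspace V L" "subspace V" "\<And>i. i \<in> I \<Longrightarrow> g i \<in> V"
  shows "L (\<Sum>i\<in>I. g i) = (\<Sum>i\<in>I. L (g i))"
  using assms(3)
proof (induction I rule: infinite_finite_induct)
  case (insert i I)
  then show ?case
    using linear_on_subspaceD(1)[OF assms(1), of "g i" "\<Sum>i\<in>I. g i"] subspace_sum[OF assms(2), of I g]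
    by simp
qed (simp_all add: linear_on_subspace_zero[OF assms(1,2)])

text \<open>A linear functional below \<open>infconv S f p\<close> is below \<open>p\<close> and, on the cone \<open>S\<close>, above \<open>f\<close>.\<close>

definition infconv :: "'v::real_vector set \<Rightarrow> ('v \<Rightarrow> real) \<Rightarrow> ('v \<Rightarrow> real) \<Rightarrow> 'v \<Rightarrow> real" where
  "infconv S f p x = (INF s\<in>S. p (x + s) - f s)"

text \<open>The setting of the Mazur-Orlicz theorem. The cone will be a ray (supporting
  functionals), the range of a linear operator with \<open>f\<close> zero (distance from a
  subspace), or the image of \<open>X\<close> (Hahn-Banach extension).\<close>

locale minorised_cone =
  fixes V S :: "'v::real_vector set" and p f :: "'v \<Rightarrow> real"
  assumes V: "subspace V" and p: "sublinear_on V p"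
    and S: "S \<subseteq> V" "0 \<in> S" "\<And>x y. x \<in> S \<Longrightarrow> y \<in> S \<Longrightarrow> x + y \<in> S"
      "\<And>x r. 0 \<le> r \<Longrightarrow> x \<in> S \<Longrightarrow> r *\<^sub>R x \<in> S"
    and f: "\<And>x y. x \<in> S \<Longrightarrow> y \<in> S \<Longrightarrow> f (x + y) = f x + f y"
      "\<And>x r. 0 \<le> r \<Longrightarrow> x \<in> S \<Longrightarrow> f (r *\<^sub>R x) = r * f x"
    and minor: "\<And>s. s \<in> S \<Longrightarrow> f s \<le> p s"
begin

lemma f_zero: "f 0 = 0"
  using f(2)[of 0 0] S by simp

lemma bdd: "x \<in> V \<Longrightarrow> bdd_below ((\<lambda>s. p (x + s) - f s) ` S)"
proof (rule bdd_belowI2)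
  fix s assume x: "x \<in> V" and s: "s \<in> S"
  have "p s \<le> p (x + s) + p (- x)"
    using sublinear_onD(1)[OF p, of "x + s" "- x"] x s S V
    by (auto simp: subspace_neg subspace_add subset_iff)
  then show "- p (- x) \<le> p (x + s) - f s"
    using minor[OF s] by simp
qed

lemma infconv_le: "x \<in> V \<Longrightarrow> s \<in> S \<Longrightarrow> infconv S f p x \<le> p (x + s) - f s"
  unfolding infconv_def by (rule cINF_lower[OF bdd])

lemma infconv_le_self: "x \<in> V \<Longrightarrow> infconv S f p x \<le> p x"
  using infconv_le[of x 0] S f_zero by simp

lemma le_infconv: "(\<And>s. s \<in> S \<Longrightarrow> c \<le> p (x + s) - f s) \<Longrightarrow> c \<le> infconv S f p x"
  unfolding infconv_def by (rule cINF_greatest) (use S in auto)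

lemma infconv_neg_le: "s \<in> S \<Longrightarrow> infconv S f p (- s) \<le> - f s"
  using infconv_le[of "- s" s] S V sublinear_on_zero[OF p V]
  by (auto simp: subspace_neg subset_iff)

lemma sublinear_on_infconv: "sublinear_on V (infconv S f p)"
proof (rule sublinear_onI[OF V])
  fix x y assume x: "x \<in> V" and y: "y \<in> V"
  have "infconv S f p (x + y) \<le> (p (x + s) - f s) + (p (y + t) - f t)" if "s \<in> S" "t \<in> S" for s t
  proof -
    have "p ((x + y) + (s + t)) \<le> p (x + s) + p (y + t)"
      using sublinear_onD(1)[OF p, of "x + s" "y + t"] x y that S V
      by (auto simp: subspace_add subset_iff algebra_simps)
    moreover have "infconv S f p (x + y) \<le> p ((x + y) + (s + t)) - f (s + t)"
      using infconv_le[of "x + y" "s + t"] x y that S V by (auto simp: subspace_add)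
    ultimately show ?thesis using f(1)[OF that] by simp
  qed
  then have "infconv S f p (x + y) - (p (y + t) - f t) \<le> infconv S f p x" if "t \<in> S" for t
    using that by (intro le_infconv) (simp add: algebra_simps)
  then have "infconv S f p (x + y) - infconv S f p x \<le> infconv S f p y"
    by (intro le_infconv) (simp add: algebra_simps)
  then show "infconv S f p (x + y) \<le> infconv S f p x + infconv S f p y" by simp
next
  fix r :: real and x assume that: "0 < r" "x \<in> V"
  have "infconv S f p (r *\<^sub>R x) / r \<le> infconv S f p x"
  proof (rule le_infconv)
    fix s assume s: "s \<in> S"
    have "infconv S f p (r *\<^sub>R x) \<le> p (r *\<^sub>R (x + s)) - f (r *\<^sub>R s)"
      using infconv_le[of "r *\<^sub>R x" "r *\<^sub>R s"] that s S V
      by (auto simp: subspace_scale algebra_simps)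
    also have "\<dots> = r * (p (x + s) - f s)"
      using sublinear_onD(2)[OF p, of r "x + s"] f(2)[of r s] that s S V
      by (auto simp: subspace_add subset_iff algebra_simps)
    finally show "infconv S f p (r *\<^sub>R x) / r \<le> p (x + s) - f s"
      using that by (simp add: field_simps)
  qed
  then show "infconv S f p (r *\<^sub>R x) \<le> r * infconv S f p x"
    using that by (simp add: field_simps)
next
  show "infconv S f p 0 = 0"
  proof (rule antisym)
    show "infconv S f p 0 \<le> 0"
      using infconv_neg_le[of 0] S f_zero by simp
    show "0 \<le> infconv S f p 0"
      by (intro le_infconv) (simp add: minor)
  qed
qed

end

text \<open>Zorn's lemma for the reversed order; the infimum of a chain is finite because
  \<open>- p (- x)\<close> bounds all members from below at \<open>x\<close>. Members are normalised
  to 0 off \<open>V\<close>, so that the pointwise order on the whole type is the order on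
  \<open>V\<close>.\<close>

lemma minimal_sublinear_exists:
  assumes V: "subspace V" and p: "sublinear_on V p"
  shows "\<exists>q. sublinear_on V q \<and> (\<forall>x\<in>V. q x \<le> p x) \<and>
    (\<forall>q'. sublinear_on V q' \<and> (\<forall>x\<in>V. q' x \<le> q x) \<longrightarrow> (\<forall>x\<in>V. q' x = q x))"
proof -
  define Q where "Q = {q. sublinear_on V q \<and> (\<forall>x\<in>V. q x \<le> p x) \<and> (\<forall>x. x \<notin> V \<longrightarrow> q x = 0)}"
  have cut: "sublinear_on V (\<lambda>x. if x \<in> V then q x else 0)" if "sublinear_on V q" for q
    using that V by (auto simp: sublinear_on_def subspace_add subspace_scale)
  have "\<exists>m\<in>Q. \<forall>a\<in>Q. a \<le> m \<longrightarrow> a = m"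
  proof (rule predicate_Zorn)
    show "partial_order_on Q (relation_of (\<lambda>a b. b \<le> a) Q)"
      by (auto simp: partial_order_on_def preorder_on_def refl_on_def trans_def antisym_def
          relation_of_def)
    fix C assume C: "C \<in> Chains (relation_of (\<lambda>a b. b \<le> a) Q)"
    then have CQ: "C \<subseteq> Q" and tot: "\<And>a b. a \<in> C \<Longrightarrow> b \<in> C \<Longrightarrow> a \<le> b \<or> b \<le> a"
      by (auto simp: Chains_def relation_of_def)
    show "\<exists>u\<in>Q. \<forall>a\<in>C. u \<le> a"
    proof (cases "C = {}")
      case True
      have "(\<lambda>x. if x \<in> V then p x else 0) \<in> Q"
        unfolding Q_def using cut[OF p] by auto
      then show ?thesis using True by blast
    next
      case ne: False
      define u where "u x = (INF q\<in>C. q x)" for x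
      have bdd: "bdd_below ((\<lambda>q. q x) ` C)" for x
      proof (cases "x \<in> V")
        case True
        show ?thesis
        proof (rule bdd_belowI2)
          fix q assume "q \<in> C"
          then have q: "q \<in> Q" using CQ by auto
          have "- q (- x) \<le> q x"
            using q sublinear_on_minus[of V q x] V True by (auto simp: Q_def)
          moreover have "q (- x) \<le> p (- x)"
            using q V True by (auto simp: Q_def subspace_neg)
          ultimately show "- p (- x) \<le> q x" by simp
        qed
      next
        case False
        then show ?thesis
          using CQ by (intro bdd_belowI2[of _ 0]) (auto simp: Q_def)
      qed
      have u_le: "u x \<le> q x" if "q \<in> C" for q x
        unfolding u_def by (rule cINF_lower[OF bdd that])
      have le_u: "c \<le> u x" if "\<And>q. q \<in> C \<Longrightarrow> c \<le> q x" for c x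
        unfolding u_def by (rule cINF_greatest) (use ne that in auto)
      have "sublinear_on V u"
      proof (rule sublinear_onI[OF V])
        fix x y assume x: "x \<in> V" and y: "y \<in> V"
        have "u (x + y) \<le> q x + q' y" if qq: "q \<in> C" "q' \<in> C" for q q'
        proof -
          \<comment> \<open>The two summands come from different members of the chain; the smaller
            member serves for both.\<close>
          obtain q'' where q'': "q'' \<in> C" "q'' \<le> q" "q'' \<le> q'"
            using tot[OF qq] qq by (metis order_refl)
          have "u (x + y) \<le> q'' (x + y)" using u_le q'' by simp
          also have "\<dots> \<le> q'' x + q'' y"
            using q'' CQ x y by (auto simp: Q_def sublinear_on_def)
          also have "\<dots> \<le> q x + q' y"
            using q'' by (auto simp: le_fun_def intro: add_mono)
          finally show ?thesis .
        qed
        then have "u (x + y) - q' y \<le> u x" if "q' \<in> C" for q'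
          using that by (intro le_u) (simp add: algebra_simps)
        then have "u (x + y) - u x \<le> u y"
          by (intro le_u) (simp add: algebra_simps)
        then show "u (x + y) \<le> u x + u y" by simp
      next
        fix r :: real and x assume r: "0 < r" and x: "x \<in> V"
        have "q (r *\<^sub>R x) = r * q x" if "q \<in> C" for q
          using that CQ r x by (auto simp: Q_def sublinear_on_def)
        then have "u (r *\<^sub>R x) / r \<le> u x"
          using r u_le[of _ "r *\<^sub>R x"] by (intro le_u) (simp add: field_simps)
        then show "u (r *\<^sub>R x) \<le> r * u x" using r by (simp add: field_simps)
      next
        have "q 0 = 0" if "q \<in> C" for q
          using that CQ sublinear_on_zero[OF _ V, of q] by (auto simp: Q_def)
        then have "(\<lambda>q. q 0) ` C = {0}" using ne by (force simp: image_iff)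
        then show "u 0 = 0" by (simp add: u_def)
      qed
      moreover have "u x \<le> p x" if "x \<in> V" for x
      proof -
        obtain q where q: "q \<in> C" using ne by auto
        show ?thesis using u_le[OF q, of x] q CQ that by (force simp: Q_def)
      qed
      moreover have "u x = 0" if "x \<notin> V" for x
      proof (rule antisym)
        obtain q where q: "q \<in> C" using ne by auto
        then show "u x \<le> 0" using u_le[OF q, of x] CQ that by (auto simp: Q_def)
        show "0 \<le> u x" using CQ that by (intro le_u) (auto simp: Q_def)
      qed
      ultimately have "u \<in> Q" by (auto simp: Q_def)
      then show ?thesis using u_le by (auto simp: le_fun_def)
    qed
  qed
  then obtain m where m: "m \<in> Q" and min: "\<And>a. a \<in> Q \<Longrightarrow> a \<le> m \<Longrightarrow> a = m" by blast
  have "q' x = m x" if q': "sublinear_on V q'" "\<forall>x\<in>V. q' x \<le> m x" and x: "x \<in> V" for q' x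
  proof -
    let ?a = "\<lambda>x. if x \<in> V then q' x else 0"
    have "?a = m"
    proof (rule min)
      show "?a \<in> Q" using cut[OF q'(1)] q'(2) m by (auto simp: Q_def intro: order_trans)
      show "?a \<le> m" using q'(2) m by (auto simp: Q_def le_fun_def)
    qed
    from fun_cong[OF this, of x] show ?thesis using x by simp
  qed
  then show ?thesis using m by (intro exI[of _ m]) (auto simp: Q_def)
qed

text \<open>A sublinear functional is additive along a ray, so \<open>q\<close> itself can be the
  prescribed functional on the cone.\<close>

lemma minorised_cone_ray:
  assumes V: "subspace V" and q: "sublinear_on V q" and a: "a \<in> V"
  shows "minorised_cone V ((\<lambda>t. t *\<^sub>R a) ` {0..}) q q" (is "minorised_cone V ?S q q")
proof
  have 1: "t *\<^sub>R a + r *\<^sub>R a \<in> ?S" if "t \<ge> 0" "r \<ge> 0" for t r :: real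
    using that by (intro image_eqI[of _ _ "t + r"]) (auto simp: scaleR_add_left)
  have 2: "t *\<^sub>R r *\<^sub>R a \<in> ?S" if "t \<ge> 0" "r \<ge> 0" for t r :: real
    using that by (intro image_eqI[of _ _ "t * r"]) auto
  show "subspace V" "sublinear_on V q" by (fact V q)+
  show "?S \<subseteq> V" using V a by (auto simp: subspace_scale)
  show "0 \<in> ?S" by (intro image_eqI[of _ _ 0]) auto
  show "x + y \<in> ?S" if "x \<in> ?S" "y \<in> ?S" for x y using that 1 by blast
  show "r *\<^sub>R x \<in> ?S" if "0 \<le> r" "x \<in> ?S" for x r using that 2 by blast
  show "q (x + y) = q x + q y" if xy: "x \<in> ?S" "y \<in> ?S" for x y
  proof -
    obtain s t where "x = s *\<^sub>R a" "y = t *\<^sub>R a" "0 \<le> s" "0 \<le> t"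
      using xy by auto
    then show ?thesis
      using sublinear_onD(2)[OF q, of _ a] a by (simp flip: scaleR_add_left add: distrib_right)
  qed
  show "q (r *\<^sub>R x) = r * q x" if "0 \<le> r" "x \<in> ?S" for x r
    using that sublinear_onD(2)[OF q, of _ x] V a by (auto simp: subspace_scale)
qed simp

text \<open>A minimal \<open>q\<close> is additive: its infimal convolution along the ray through
  \<open>a\<close> is sublinear and below \<open>q\<close>, hence equal to \<open>q\<close>, which
  gives \<open>q x + q a \<le> q (x + a)\<close>.\<close>

lemma linear_minorant_exists:
  assumes V: "subspace V" and p: "sublinear_on V p"
  shows "\<exists>L. linear_on_subspace V L \<and> (\<forall>x\<in>V. L x \<le> p x)"
proof -
  obtain q where q: "sublinear_on V q" and qp: "\<forall>x\<in>V. q x \<le> p x"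
    and min: "\<And>q' x. sublinear_on V q' \<Longrightarrow> \<forall>x\<in>V. q' x \<le> q x \<Longrightarrow> x \<in> V \<Longrightarrow> q' x = q x"
    using minimal_sublinear_exists[OF V p] by metis
  have add: "q (x + a) = q x + q a" if x: "x \<in> V" and a: "a \<in> V" for x a
  proof (rule antisym)
    show "q (x + a) \<le> q x + q a" using sublinear_onD(1)[OF q x a] .
    let ?S = "(\<lambda>t. t *\<^sub>R a) ` {0..}"
    interpret minorised_cone V ?S q q by (rule minorised_cone_ray[OF V q a])
    have "infconv ?S q q x = q x"
      using infconv_le_self by (intro min[OF sublinear_on_infconv _ x]) auto
    moreover have "a \<in> ?S" by (intro image_eqI[of _ _ 1]) auto
    ultimately show "q x + q a \<le> q (x + a)"
      using infconv_le[OF x, of a] by simp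
  qed
  have "q (r *\<^sub>R x) = r * q x" if x: "x \<in> V" for r x
  proof (cases "r \<ge> 0")
    case True
    then show ?thesis using sublinear_onD(2)[OF q _ x] by simp
  next
    case False
    have "q ((- r) *\<^sub>R x) = - r * q x"
      using False x by (intro sublinear_onD(2)[OF q]) auto
    moreover have "q ((- r) *\<^sub>R x + r *\<^sub>R x) = q ((- r) *\<^sub>R x) + q (r *\<^sub>R x)"
      using x V by (intro add) (auto simp: subspace_scale subspace_neg)
    ultimately show ?thesis using sublinear_on_zero[OF q V] by simp
  qed
  then show ?thesis using add qp by (intro exI[of _ q]) (auto simp: linear_on_subspace_def)
qed

theorem (in minorised_cone) Mazur_Orlicz:
  "\<exists>L. linear_on_subspace V L \<and> (\<forall>x\<in>V. L x \<le> p x) \<and> (\<forall>s\<in>S. f s \<le> L s)"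
proof -
  obtain L where L: "linear_on_subspace V L" "\<forall>x\<in>V. L x \<le> infconv S f p x"
    using linear_minorant_exists[OF V sublinear_on_infconv] by blast
  have "f s \<le> L s" if s: "s \<in> S" for s
  proof -
    have sV: "s \<in> V" "- s \<in> V" using s S V by (auto simp: subspace_neg)
    have "L (- s) = - L s" using linear_on_subspaceD(2)[OF L(1) sV(1), of "-1"] by simp
    moreover have "L (- s) \<le> - f s" using L(2) sV infconv_neg_le[OF s] by (meson order_trans)
    ultimately show ?thesis by simp
  qed
  moreover have "L x \<le> p x" if "x \<in> V" for x
    using that L(2) infconv_le_self by (meson order_trans)
  ultimately show ?thesis using L(1) by blast
qed

corollary supporting_functional_exists:
  assumes V: "subspace V" and p: "sublinear_on V p" and a: "a \<in> V"
  obtains L where "linear_on_subspace V L" "\<And>x. x \<in> V \<Longrightarrow> L x \<le> p x" "L a = p a"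
proof -
  let ?S = "(\<lambda>t. t *\<^sub>R a) ` {0..}"
  interpret minorised_cone V ?S p p by (rule minorised_cone_ray[OF assms])
  have "a \<in> ?S" by (intro image_eqI[of _ _ 1]) auto
  with Mazur_Orlicz that a show thesis by (metis antisym)
qed

section \<open>Banach limits and uniform boundedness\<close>

text \<open>A linear functional below the upper limit is automatically above the lower limit, by
  applying the inequality to \<open>- s\<close>.\<close>

lemma Banach_limit_exists:
  obtains L :: "(nat \<Rightarrow> real) \<Rightarrow> real"
  where "linear_on_subspace {s. Bseq s} L"
    and "\<And>s K. (\<And>n. \<bar>s n\<bar> \<le> K) \<Longrightarrow> \<bar>L s\<bar> \<le> K"
    and "\<And>s l. s \<longlonglongrightarrow> l \<Longrightarrow> L s = l"
proof -
  let ?V = "{s :: nat \<Rightarrow> real. Bseq s}"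
  \<comment> \<open>\<open>Inf (A s)\<close> is the upper limit of \<open>s\<close>.\<close>
  define A where "A s = {K. \<forall>\<^sub>F n in sequentially. s n \<le> K}" for s :: "nat \<Rightarrow> real"
  have V: "subspace ?V"
  proof (rule subspaceI)
    show "0 \<in> ?V" by (simp add: zero_fun_def)
  next
    fix s t :: "nat \<Rightarrow> real" assume "s \<in> ?V" "t \<in> ?V"
    then obtain K K' where "\<And>n. norm (s n) \<le> K" "\<And>n. norm (t n) \<le> K'"
      by (auto simp: Bseq_def)
    then have "norm ((s + t) n) \<le> K + K'" for n
      unfolding plus_fun_apply by (rule norm_triangle_mono)
    then show "s + t \<in> ?V" by (auto intro!: BseqI'[of _ "K + K'"])
  next
    fix r and s :: "nat \<Rightarrow> real" assume "s \<in> ?V"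
    then show "r *\<^sub>R s \<in> ?V"
      using Bseq_mult[of "\<lambda>_. r" s] by (simp add: scaleR_fun_def)
  qed
  have ne: "A s \<noteq> {}" and bdd: "bdd_below (A s)" if s: "Bseq s" for s
  proof -
    obtain B where B: "\<And>n. \<bar>s n\<bar> \<le> B" using s by (auto simp: Bseq_def)
    have "B \<in> A s" using B by (auto simp: A_def intro!: always_eventually) (metis abs_le_D1)
    then show "A s \<noteq> {}" by auto
    have "- B \<le> K" if K: "K \<in> A s" for K
    proof -
      obtain n where "s n \<le> K" using K unfolding A_def eventually_sequentially by blast
      then show ?thesis using B[of n] by linarith
    qed
    then show "bdd_below (A s)" by (rule bdd_belowI)
  qed
  have Inf_le: "Inf (A s) \<le> K" if "Bseq s" "K \<in> A s" for s K
    using cInf_lower[OF that(2) bdd[OF that(1)]] .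
  have p: "sublinear_on ?V (\<lambda>s. Inf (A s))"
  proof (rule sublinear_onI[OF V])
    fix s t :: "nat \<Rightarrow> real" assume "s \<in> ?V" "t \<in> ?V"
    then have st: "Bseq s" "Bseq t" and st': "Bseq (s + t)" using V subspace_add by blast+
    have "Inf (A (s + t)) \<le> K + K'" if "K \<in> A s" "K' \<in> A t" for K K'
    proof (rule Inf_le[OF st'])
      show "K + K' \<in> A (s + t)"
        using that eventually_conj[of "\<lambda>n. s n \<le> K" sequentially "\<lambda>n. t n \<le> K'"]
        unfolding A_def by (auto elim!: eventually_mono[of "\<lambda>n. _ n \<and> _ n"])
    qed
    then have "Inf (A (s + t)) - K' \<le> Inf (A s)" if "K' \<in> A t" for K'
      using that ne[OF st(1)] by (intro cInf_greatest) (auto simp: algebra_simps)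
    then have "Inf (A (s + t)) - Inf (A s) \<le> Inf (A t)"
      using ne[OF st(2)] by (intro cInf_greatest) (auto simp: algebra_simps)
    then show "Inf (A (s + t)) \<le> Inf (A s) + Inf (A t)" by simp
  next
    fix s :: "nat \<Rightarrow> real" and r :: real assume r: "0 < r" and "s \<in> ?V"
    then have s: "Bseq s" and rs: "Bseq (r *\<^sub>R s)" using V subspace_scale by blast+
    have "Inf (A (r *\<^sub>R s)) / r \<le> Inf (A s)"
    proof (rule cInf_greatest[OF ne[OF s]])
      fix K assume "K \<in> A s"
      then have "r * K \<in> A (r *\<^sub>R s)"
        using r by (auto simp: A_def elim: eventually_mono)
      then show "Inf (A (r *\<^sub>R s)) / r \<le> K"
        using Inf_le[OF rs] r by (simp add: field_simps)
    qed
    then show "Inf (A (r *\<^sub>R s)) \<le> r * Inf (A s)" using r by (simp add: field_simps)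
  next
    have "A 0 = {0..}" by (auto simp: A_def)
    then show "Inf (A 0) = 0" by simp
  qed
  obtain L where L: "linear_on_subspace ?V L" and le: "\<And>s. Bseq s \<Longrightarrow> L s \<le> Inf (A s)"
    using linear_minorant_exists[OF V p] by auto
  have L_le: "L s \<le> K" if "Bseq s" "\<forall>\<^sub>F n in sequentially. s n \<le> K" for s K
    using le[OF that(1)] Inf_le[OF that(1), of K] that(2) by (simp add: A_def)
  have L_ge: "K \<le> L s" if "Bseq s" "\<forall>\<^sub>F n in sequentially. K \<le> s n" for s K
  proof -
    have "Bseq (- s)" using V that(1) subspace_neg by blast
    then have "L (- s) \<le> - K" using that(2) by (intro L_le) auto
    then show ?thesis using linear_on_subspaceD(2)[OF L, of s "-1"] that(1) by simp
  qed
  show ?thesis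
  proof (rule that[OF L])
    fix s :: "nat \<Rightarrow> real" and K assume *: "\<And>n. \<bar>s n\<bar> \<le> K"
    then have "Bseq s" by (intro BseqI') auto
    moreover have "s n \<le> K" "- K \<le> s n" for n using *[of n] by linarith+
    ultimately show "\<bar>L s\<bar> \<le> K" using L_le[of s K] L_ge[of s "- K"] by (simp add: abs_le_iff)
  next
    fix s :: "nat \<Rightarrow> real" and l assume s: "s \<longlonglongrightarrow> l"
    then have b: "Bseq s" using convergent_imp_Bseq convergent_def by blast
    show "L s = l"
    proof (rule antisym; rule field_le_epsilon)
      fix e :: real assume "0 < e"
      then have "\<forall>\<^sub>F n in sequentially. s n \<le> l + e" "\<forall>\<^sub>F n in sequentially. l - e \<le> s n"
        using order_tendstoD(2)[OF s, of "l + e"] order_tendstoD(1)[OF s, of "l - e"]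
        by (auto elim: eventually_mono)
      then have "L s \<le> l + e" "l - e \<le> L s" using L_le[OF b] L_ge[OF b] by blast+
      then show "L s \<le> l + e" "l \<le> L s + e" by simp_all
    qed
  qed
qed

text \<open>By Baire's theorem one of the closed sets \<open>F k\<close>, which cover the space,
  contains a ball; a small multiple of any \<open>y\<close> is a difference of two points of that
  ball.\<close>

lemma uniform_boundedness:
  fixes v :: "nat \<Rightarrow> 'a::banach \<Rightarrow>\<^sub>L 'b::real_normed_vector"
  assumes pt: "\<And>x. Bseq (\<lambda>n. v n x)"
  shows "\<exists>K. \<forall>n. norm (v n) \<le> K"
proof -
  define F where "F k = {x. \<forall>n. norm (v n x) \<le> real k}" for k :: nat
  have closed: "closed (F k)" for k
    unfolding F_def by (intro closed_Collect_all closed_Collect_le continuous_intros)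
  have "(\<Union>k. F k) = UNIV"
  proof -
    have "\<exists>k. x \<in> F k" for x
    proof -
      obtain B where "\<And>n. norm (v n x) \<le> B" using pt[of x] by (auto simp: Bseq_def)
      moreover obtain k :: nat where "B \<le> real k" using real_arch_simple by blast
      ultimately show ?thesis by (auto simp: F_def intro: order_trans)
    qed
    then show ?thesis by auto
  qed
  moreover have "interior (\<Union>(range F)) = {}" if "\<And>k. interior (F k) = {}"
    using Baire_category_alt[of "euclidean :: 'a topology" "range F"]
      completely_metrizable_space_euclidean closed that by auto
  ultimately obtain k where "interior (F k) \<noteq> {}" by (metis UNIV_not_empty interior_UNIV)
  then obtain x where "x \<in> interior (F k)" by blast
  then obtain e where e: "e > 0" "ball x e \<subseteq> F k" by (auto simp: mem_interior)
  have "norm (v n) \<le> 4 * real k / e" for n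
  proof (rule norm_blinfun_bound)
    show "0 \<le> 4 * real k / e" using e by simp
    fix y
    show "norm (v n y) \<le> 4 * real k / e * norm y"
    proof (cases "y = 0")
      case False
      \<comment> \<open>Half the radius keeps \<open>x + t *\<^sub>R y\<close> in the open ball; the
        bound \<open>2 * k / t\<close> is then \<open>4 * k / e * norm y\<close>.\<close>
      define t where "t = e / (2 * norm y)"
      have t: "t > 0" using e False by (simp add: t_def)
      have "x + t *\<^sub>R y \<in> ball x e" "x \<in> ball x e"
        using e False by (auto simp: dist_norm t_def)
      then have "norm (v n (x + t *\<^sub>R y)) \<le> k" "norm (v n x) \<le> k"
        using e(2) unfolding F_def by blast+
      moreover have "t *\<^sub>R v n y = v n (x + t *\<^sub>R y) - v n x"
        by (simp add: blinfun.bilinear_simps)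
      ultimately have "norm (t *\<^sub>R v n y) \<le> 2 * real k"
        using norm_triangle_ineq4[of "v n (x + t *\<^sub>R y)" "v n x"] by simp
      then have "t * norm (v n y) \<le> 2 * real k" using t by simp
      then show ?thesis using t e False by (simp add: t_def field_simps)
    qed simp
  qed
  then show ?thesis by blast
qed

section \<open>The dual of a normed space given by a carrier\<close>

lemma dual_nspace_ops:
  "vadd (dual_nspace Z) \<phi> \<psi> = (\<lambda>x\<in>carr Z. \<phi> x + \<psi> x)"
  "vscale (dual_nspace Z) a \<phi> = (\<lambda>x\<in>carr Z. a * \<phi> x)"
  by (simp_all add: dual_nspace_def)

context normed_nspace
begin

lemma norm_nonneg: "x \<in> carr Z \<Longrightarrow> 0 \<le> vnorm Z x"
  using norm_triangle[of x "vscale Z (-1) x"] norm_scale[of x "-1"] add_inverse[of x]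
    norm_eq_zero[OF zero_in] scale_in[of x "-1"] by simp

lemma mem_dualI:
  assumes "\<phi> \<in> extensional (carr Z)"
    and "\<And>x y. x \<in> carr Z \<Longrightarrow> y \<in> carr Z \<Longrightarrow> \<phi> (vadd Z x y) = \<phi> x + \<phi> y"
    and "\<And>a x. x \<in> carr Z \<Longrightarrow> \<phi> (vscale Z a x) = a * \<phi> x"
    and "\<And>x. x \<in> carr Z \<Longrightarrow> \<bar>\<phi> x\<bar> \<le> K * vnorm Z x"
  shows "\<phi> \<in> carr (dual_nspace Z)"
  unfolding dual_nspace_def bounded_linear_map_def nspace.simps mem_Collect_eq nspace_of_simps real_norm_def
  using assms by (intro conjI exI[of _ K]) auto

lemma dual_memD:
  assumes "\<phi> \<in> carr (dual_nspace Z)"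
  shows "\<phi> \<in> extensional (carr Z)"
    and "x \<in> carr Z \<Longrightarrow> y \<in> carr Z \<Longrightarrow> \<phi> (vadd Z x y) = \<phi> x + \<phi> y"
    and "x \<in> carr Z \<Longrightarrow> \<phi> (vscale Z a x) = a * \<phi> x"
  using assms by (auto simp: dual_nspace_def bounded_linear_map_def)

lemma bdd_above_dual:
  assumes \<phi>: "\<phi> \<in> carr (dual_nspace Z)"
  shows "bdd_above ((\<lambda>x. \<bar>\<phi> x\<bar>) ` {x \<in> carr Z. vnorm Z x \<le> 1})"
proof -
  obtain K where K: "\<And>x. x \<in> carr Z \<Longrightarrow> \<bar>\<phi> x\<bar> \<le> K * vnorm Z x"
    using \<phi> unfolding dual_nspace_def bounded_linear_map_def nspace.simps nspace_of_simps
      real_norm_def by blast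
  show ?thesis
  proof (rule bdd_aboveI2)
    fix x assume x: "x \<in> {x \<in> carr Z. vnorm Z x \<le> 1}"
    then have "\<bar>\<phi> x\<bar> \<le> K * vnorm Z x" using K by auto
    also have "\<dots> \<le> \<bar>K\<bar> * 1"
      using x norm_nonneg by (intro mult_mono) auto
    finally show "\<bar>\<phi> x\<bar> \<le> \<bar>K\<bar>" by simp
  qed
qed

lemma dual_norm_bound:
  assumes \<phi>: "\<phi> \<in> carr (dual_nspace Z)" and x: "x \<in> carr Z"
  shows "\<bar>\<phi> x\<bar> \<le> vnorm (dual_nspace Z) \<phi> * vnorm Z x"
proof (cases "vnorm Z x = 0")
  case True
  then have "x = vscale Z 0 x"
    using norm_eq_zero[OF x] norm_eq_zero[OF scale_in[OF x]] norm_scale[OF x, of 0] by simp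
  then have "\<phi> x = 0" using dual_memD(3)[OF \<phi> x, of 0] by simp
  then show ?thesis using True by simp
next
  case False
  then have pos: "vnorm Z x > 0" using norm_nonneg[OF x] by simp
  have "\<bar>\<phi> (vscale Z (inverse (vnorm Z x)) x)\<bar> \<le> vnorm (dual_nspace Z) \<phi>"
    unfolding dual_nspace_def nspace.simps
    using pos x by (intro cSUP_upper[OF _ bdd_above_dual[OF \<phi>]]) (auto simp: scale_in norm_scale)
  then show ?thesis
    using pos x dual_memD(3)[OF \<phi> x] by (simp add: abs_mult field_simps)
qed

lemma dual_add_in:
  assumes \<phi>: "\<phi> \<in> carr (dual_nspace Z)" and \<psi>: "\<psi> \<in> carr (dual_nspace Z)"
  shows "vadd (dual_nspace Z) \<phi> \<psi> \<in> carr (dual_nspace Z)"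
proof (rule mem_dualI)
  fix x assume x: "x \<in> carr Z"
  show "\<bar>vadd (dual_nspace Z) \<phi> \<psi> x\<bar>
      \<le> (vnorm (dual_nspace Z) \<phi> + vnorm (dual_nspace Z) \<psi>) * vnorm Z x"
    using dual_norm_bound[OF \<phi> x] dual_norm_bound[OF \<psi> x] x
    by (simp add: dual_nspace_ops algebra_simps)
qed (auto simp: dual_nspace_ops add_in scale_in dual_memD[OF \<phi>] dual_memD[OF \<psi>] algebra_simps)

lemma dual_scale_in:
  assumes \<phi>: "\<phi> \<in> carr (dual_nspace Z)"
  shows "vscale (dual_nspace Z) a \<phi> \<in> carr (dual_nspace Z)"
proof (rule mem_dualI)
  fix x assume x: "x \<in> carr Z"
  show "\<bar>vscale (dual_nspace Z) a \<phi> x\<bar> \<le> (\<bar>a\<bar> * vnorm (dual_nspace Z) \<phi>) * vnorm Z x"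
    using mult_left_mono[OF dual_norm_bound[OF \<phi> x], of "\<bar>a\<bar>"] x
    by (simp add: dual_nspace_ops abs_mult algebra_simps)
qed (auto simp: dual_nspace_ops add_in scale_in dual_memD[OF \<phi>] algebra_simps)

lemma dual_norm_le:
  assumes "0 \<le> K" and "\<And>x. x \<in> carr Z \<Longrightarrow> \<bar>\<phi> x\<bar> \<le> K * vnorm Z x"
  shows "vnorm (dual_nspace Z) \<phi> \<le> K"
  unfolding dual_nspace_def nspace.simps
proof (rule cSUP_least)
  show "{x \<in> carr Z. vnorm Z x \<le> 1} \<noteq> {}"
    using zero_in norm_eq_zero[OF zero_in] by auto
  fix x assume x: "x \<in> {x \<in> carr Z. vnorm Z x \<le> 1}"
  then have "\<bar>\<phi> x\<bar> \<le> K * vnorm Z x" using assms by auto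
  also have "\<dots> \<le> K" using x assms(1) by (simp add: mult_left_le)
  finally show "\<bar>\<phi> x\<bar> \<le> K" .
qed

lemma dual_norm_nonneg: "0 \<le> vnorm (dual_nspace Z) \<phi>" if "\<phi> \<in> carr (dual_nspace Z)"
proof -
  have "0 \<le> \<bar>\<phi> (vzero Z)\<bar>" by simp
  also have "\<dots> \<le> vnorm (dual_nspace Z) \<phi>"
    unfolding dual_nspace_def nspace.simps
    using zero_in norm_eq_zero[OF zero_in] by (intro cSUP_upper[OF _ bdd_above_dual[OF that]]) auto
  finally show ?thesis .
qed

end

section \<open>From quasibasic subspaces to projections\<close>

text \<open>The uniform boundedness principle supplies the bound \<open>B\<close> for the
  \<open>v n\<close>. It makes the sequences fed to the Banach limit bounded, and the projection
  gets norm at most \<open>1 + K * B\<close>.\<close>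

lemma quasibasic_imp_complemented_annihilator:
  fixes Z :: "'z nspace" and J :: "'a::banach \<Rightarrow> 'z"
  assumes Z: "normed_nspace Z" and J: "isometric_embedding (nspace_of UNIV) Z J"
    and qb: "quasibasic M" and ext: "boundedly_extendable M Z J"
  shows "complemented_in (annihilator Z (range J)) (dual_nspace Z)"
proof -
  interpret normed_nspace Z by (fact Z)
  let ?D = "dual_nspace Z"
  have J: "J x \<in> carr Z" "J (x + y) = vadd Z (J x) (J y)" "J (r *\<^sub>R x) = vscale Z r (J x)"
    "vnorm Z (J x) = norm x" for x y r
    using J by (auto simp: isometric_embedding_def bounded_linear_map_def)
  obtain v :: "nat \<Rightarrow> 'a \<Rightarrow>\<^sub>L 'a"
    where v: "\<And>x. (\<lambda>n. norm (v n x - x)) \<longlonglongrightarrow> 0"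
      and vM: "\<And>n. range (blinfun_adjoint (v n)) \<subseteq> M"
    using qb by (auto simp: quasibasic_def)
  have v: "(\<lambda>n. v n x) \<longlonglongrightarrow> x" for x
    using v[of x] by (simp add: tendsto_norm_zero_iff LIM_zero_iff)
  then have "Bseq (\<lambda>n. v n x)" for x
    using convergent_imp_Bseq convergent_def by blast
  then obtain B where B: "\<And>n. norm (v n) \<le> B"
    using uniform_boundedness[of v] by blast
  have B0: "0 \<le> B" using B[of 0] norm_ge_zero order_trans by blast
  have vM: "f o\<^sub>L v n \<in> M" for f :: "'a \<Rightarrow>\<^sub>L real" and n
    using vM[of n] by (auto simp: blinfun_adjoint_def)
  obtain \<pi> where \<pi>: "isomorphic_embedding (nspace_of M) ?D \<pi>"
    and \<pi>J: "\<And>f x. f \<in> M \<Longrightarrow> \<pi> f (J x) = blinfun_apply f x"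
    using ext by (auto simp: boundedly_extendable_def)
  have \<pi>D: "\<pi> f \<in> carr ?D" if "f \<in> M" for f
    using \<pi> that by (auto simp: isomorphic_embedding_def bounded_linear_map_def)
  have \<pi>_add: "\<pi> (f + g) z = \<pi> f z + \<pi> g z" if "f \<in> M" "g \<in> M" "z \<in> carr Z" for f g z
    using \<pi> that by (simp add: isomorphic_embedding_def bounded_linear_map_def dual_nspace_ops)
  have \<pi>_scale: "\<pi> (r *\<^sub>R f) z = r * \<pi> f z" if "f \<in> M" "z \<in> carr Z" for f r z
    using \<pi> that by (simp add: isomorphic_embedding_def bounded_linear_map_def dual_nspace_ops)
  obtain K' where K': "\<And>f. f \<in> M \<Longrightarrow> vnorm ?D (\<pi> f) \<le> K' * norm f"
    using \<pi> unfolding isomorphic_embedding_def bounded_linear_map_def nspace_of_simps by blast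
  \<comment> \<open>\<open>K'\<close> may be negative if \<open>M\<close> is the zero space.\<close>
  define K where "K = max K' 0"
  have K0: "0 \<le> K" by (simp add: K_def)
  have \<pi>_bound: "\<bar>\<pi> (f o\<^sub>L v n) z\<bar> \<le> K * B * norm f * vnorm Z z" if z: "z \<in> carr Z" for f n z
  proof -
    have "vnorm ?D (\<pi> (f o\<^sub>L v n)) \<le> K' * norm (f o\<^sub>L v n)"
      using K'[OF vM] .
    also have "\<dots> \<le> K * (norm f * B)"
      using K0 B0 B[of n] norm_blinfun_compose[of f "v n"]
      by (intro mult_mono) (auto simp: K_def intro: order_trans[OF _ mult_left_mono])
    finally have "vnorm ?D (\<pi> (f o\<^sub>L v n)) * vnorm Z z \<le> K * (norm f * B) * vnorm Z z"
      using norm_nonneg[OF z] by (intro mult_right_mono) auto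
    with dual_norm_bound[OF \<pi>D[OF vM] z, of f n] show ?thesis by (simp add: algebra_simps)
  qed
  obtain L where L: "linear_on_subspace {s. Bseq s} L"
    and L_bound: "\<And>s K. (\<And>n. \<bar>s n\<bar> \<le> K) \<Longrightarrow> \<bar>L s\<bar> \<le> K"
    and L_lim: "\<And>s l. s \<longlonglongrightarrow> l \<Longrightarrow> L s = l"
    using Banach_limit_exists by blast
  define E where "E f z = L (\<lambda>n. \<pi> (f o\<^sub>L v n) z)" for f z
  have bs: "Bseq (\<lambda>n. \<pi> (f o\<^sub>L v n) z)" if "z \<in> carr Z" for f z
    using \<pi>_bound[OF that] by (intro BseqI') simp
  have L_add: "L (\<lambda>n. s n + t n) = L s + L t" if "Bseq s" "Bseq t" for s t
    using linear_on_subspaceD(1)[OF L, of s t] that by (simp add: plus_fun_def)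
  have L_scale: "L (\<lambda>n. r * s n) = r * L s" if "Bseq s" for s r
    using linear_on_subspaceD(2)[OF L, of s r] that by (simp add: scaleR_fun_def)
  have E_add: "E (f + g) z = E f z + E g z" if z: "z \<in> carr Z" for f g z
    unfolding E_def using bs[OF z] \<pi>_add[OF vM vM z]
    by (simp add: bounded_bilinear.add_left[OF bounded_bilinear_blinfun_compose] L_add)
  have E_scale: "E (r *\<^sub>R f) z = r * E f z" if z: "z \<in> carr Z" for f r z
    unfolding E_def using bs[OF z] \<pi>_scale[OF vM z]
    by (simp add: bounded_bilinear.scaleR_left[OF bounded_bilinear_blinfun_compose] L_scale)
  have E_vadd: "E f (vadd Z z w) = E f z + E f w" if "z \<in> carr Z" "w \<in> carr Z" for f z w
    unfolding E_def using bs that by (simp add: dual_memD(2)[OF \<pi>D[OF vM]] L_add)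
  have E_vscale: "E f (vscale Z r z) = r * E f z" if "z \<in> carr Z" for f z r
    unfolding E_def using bs that by (simp add: dual_memD(3)[OF \<pi>D[OF vM]] L_scale)
  have E_bound: "\<bar>E f z\<bar> \<le> K * B * norm f * vnorm Z z" if "z \<in> carr Z" for f z
    unfolding E_def by (intro L_bound \<pi>_bound that)
  \<comment> \<open>On \<open>J x\<close> the sequence is \<open>f (v n x)\<close>, which converges,
    so the Banach limit is its limit.\<close>
  have E_J: "E f (J x) = f x" for f x
    unfolding E_def \<pi>J[OF vM] blinfun_apply_blinfun_compose
    by (intro L_lim tendsto_intros v)
  \<comment> \<open>Restriction to \<open>X\<close>. \<open>Blinfun\<close> returns the intended
    operator once the function is known to be bounded linear, hence the hypothesis in
    \<open>R_apply\<close>.\<close>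
  define R where "R \<phi> = Blinfun (\<lambda>x. \<phi> (J x))" for \<phi> :: "'z \<Rightarrow> real"
  have R_apply: "R \<phi> x = \<phi> (J x)" if \<phi>: "\<phi> \<in> carr ?D" for \<phi> x
  proof -
    have "bounded_linear (\<lambda>x. \<phi> (J x))"
      using dual_memD[OF \<phi>] dual_norm_bound[OF \<phi>, of "J _"] J
      by (intro bounded_linear_intro[of _ "vnorm ?D \<phi>"]) (auto simp: mult.commute)
    then show ?thesis by (simp add: R_def bounded_linear_Blinfun_apply)
  qed
  have R_bound: "norm (R \<phi>) \<le> vnorm ?D \<phi>" if \<phi>: "\<phi> \<in> carr ?D" for \<phi>
    using dual_norm_nonneg[OF \<phi>] dual_norm_bound[OF \<phi>, of "J _"] J
    by (intro norm_blinfun_bound) (auto simp: R_apply[OF \<phi>])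
  define P where "P \<phi> = (\<lambda>z\<in>carr Z. \<phi> z - E (R \<phi>) z)" for \<phi>
  have P_bound: "\<bar>P \<phi> z\<bar> \<le> (1 + K * B) * vnorm ?D \<phi> * vnorm Z z"
    if \<phi>: "\<phi> \<in> carr ?D" and z: "z \<in> carr Z" for \<phi> z
  proof -
    have "\<bar>P \<phi> z\<bar> \<le> \<bar>\<phi> z\<bar> + \<bar>E (R \<phi>) z\<bar>" using z by (simp add: P_def)
    also have "\<bar>E (R \<phi>) z\<bar> \<le> K * B * norm (R \<phi>) * vnorm Z z" by (rule E_bound[OF z])
    also have "\<dots> \<le> K * B * vnorm ?D \<phi> * vnorm Z z"
      using K0 B0 R_bound[OF \<phi>] norm_nonneg[OF z]
      by (intro mult_right_mono mult_left_mono) auto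
    also have "\<bar>\<phi> z\<bar> \<le> vnorm ?D \<phi> * vnorm Z z" by (rule dual_norm_bound[OF \<phi> z])
    finally show ?thesis by (simp add: algebra_simps)
  qed
  have P_dual: "P \<phi> \<in> carr ?D" if \<phi>: "\<phi> \<in> carr ?D" for \<phi>
    by (rule mem_dualI[OF _ _ _ P_bound[OF \<phi>]])
      (auto simp: P_def extensional_def add_in scale_in dual_memD[OF \<phi>] E_vadd E_vscale algebra_simps)
  show ?thesis
    unfolding complemented_in_def
  proof (intro exI[of _ P] conjI)
    have R_add: "R (vadd ?D \<phi> \<psi>) = R \<phi> + R \<psi>" if "\<phi> \<in> carr ?D" "\<psi> \<in> carr ?D" for \<phi> \<psi>
      using that by (intro blinfun_eqI)
        (simp add: R_apply dual_add_in blinfun.add_left, simp add: dual_nspace_ops J)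
    have R_scale: "R (vscale ?D a \<phi>) = a *\<^sub>R R \<phi>" if "\<phi> \<in> carr ?D" for \<phi> a
      using that by (intro blinfun_eqI)
        (simp add: R_apply dual_scale_in blinfun.scaleR_left, simp add: dual_nspace_ops J)
    show "bounded_linear_map ?D ?D P"
      unfolding bounded_linear_map_def
    proof (intro conjI ballI allI exI[of _ "1 + K * B"])
      show "P \<in> carr ?D \<rightarrow> carr ?D" using P_dual by blast
      show "P (vadd ?D \<phi> \<psi>) = vadd ?D (P \<phi>) (P \<psi>)" if "\<phi> \<in> carr ?D" "\<psi> \<in> carr ?D" for \<phi> \<psi>
        using R_add[OF that] by (auto simp: P_def dual_nspace_ops E_add)
      show "P (vscale ?D a \<phi>) = vscale ?D a (P \<phi>)" if "\<phi> \<in> carr ?D" for a \<phi>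
        using R_scale[OF that] by (auto simp: P_def dual_nspace_ops E_scale algebra_simps)
      show "vnorm ?D (P \<phi>) \<le> (1 + K * B) * vnorm ?D \<phi>" if "\<phi> \<in> carr ?D" for \<phi>
        using K0 B0 dual_norm_nonneg[OF that] P_bound[OF that] by (intro dual_norm_le) auto
    qed
    have P_id: "P \<phi> = \<phi>" if \<phi>: "\<phi> \<in> annihilator Z (range J)" for \<phi>
    proof
      fix z
      have \<phi>': "\<phi> \<in> carr ?D" using \<phi> by (simp add: annihilator_def)
      have "R \<phi> = 0" using \<phi> by (intro blinfun_eqI) (auto simp: R_apply[OF \<phi>'] annihilator_def)
      then have "E (R \<phi>) z = 0" if "z \<in> carr Z" using E_scale[OF that, of 0 0] by simp
      then show "P \<phi> z = \<phi> z"
        using dual_memD(1)[OF \<phi>'] by (auto simp: P_def extensional_def)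
    qed
    then show "\<forall>y\<in>annihilator Z (range J). P y = y" by blast
    have "P \<phi> \<in> annihilator Z (range J)" if "\<phi> \<in> carr ?D" for \<phi>
      using P_dual[OF that] J by (auto simp: annihilator_def P_def E_J R_apply[OF that])
    moreover have "annihilator Z (range J) \<subseteq> carr ?D" by (auto simp: annihilator_def)
    ultimately show "P ` carr ?D = annihilator Z (range J)"
      using P_id by (metis (no_types, lifting) image_eqI image_subsetI subsetD subsetI subset_antisym)
  qed
qed

section \<open>Local reflexivity\<close>

lemma sum_fun_apply: "(\<Sum>i\<in>I. g i) x = (\<Sum>i\<in>I. g i x)"
  by (induction I rule: infinite_finite_induct) simp_all

text \<open>Functionals on \<open>M\<close> are fixed to be \<open>0\<close> off \<open>M\<close>, so that they form a subspace of the function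
  type.\<close>

definition dual_on :: "'b::real_normed_vector set \<Rightarrow> ('b \<Rightarrow> real) set" where
  "dual_on M = {\<phi>. (\<forall>f. f \<notin> M \<longrightarrow> \<phi> f = 0) \<and> linear_on_subspace M \<phi> \<and>
     (\<exists>K. \<forall>f\<in>M. \<bar>\<phi> f\<bar> \<le> K * norm f)}"

lemma subspace_dual_on: "subspace (dual_on M)"
proof (rule subspaceI)
  show "0 \<in> dual_on M"
    by (auto simp: dual_on_def linear_on_subspace_def intro!: exI[of _ 0])
next
  fix \<phi> \<psi> assume \<phi>: "\<phi> \<in> dual_on M" and \<psi>: "\<psi> \<in> dual_on M"
  obtain K K' where "\<And>f. f \<in> M \<Longrightarrow> \<bar>\<phi> f\<bar> \<le> K * norm f" "\<And>f. f \<in> M \<Longrightarrow> \<bar>\<psi> f\<bar> \<le> K' * norm f"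
    using \<phi> \<psi> unfolding dual_on_def by blast
  then have "\<bar>(\<phi> + \<psi>) f\<bar> \<le> (K + K') * norm f" if "f \<in> M" for f
    using that abs_triangle_ineq[of "\<phi> f" "\<psi> f"] by (force simp: distrib_right)
  with \<phi> \<psi> show "\<phi> + \<psi> \<in> dual_on M"
    unfolding dual_on_def linear_on_subspace_def by (auto simp: distrib_left intro!: exI[of _ "K + K'"])
next
  fix r \<phi> assume \<phi>: "\<phi> \<in> dual_on M"
  obtain K where "\<And>f. f \<in> M \<Longrightarrow> \<bar>\<phi> f\<bar> \<le> K * norm f"
    using \<phi> unfolding dual_on_def by blast
  then have "\<bar>(r *\<^sub>R \<phi>) f\<bar> \<le> (\<bar>r\<bar> * K) * norm f" if "f \<in> M" for f
    using that mult_left_mono[of "\<bar>\<phi> f\<bar>" "K * norm f" "\<bar>r\<bar>"] by (simp add: abs_mult mult.assoc)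
  with \<phi> show "r *\<^sub>R \<phi> \<in> dual_on M"
    unfolding dual_on_def linear_on_subspace_def
    by (auto simp: distrib_left mult.left_commute intro!: exI[of _ "\<bar>r\<bar> * K"])
qed

text \<open>
  Local reflexivity for a finite system of constraints: bidual elements \<open>\<phi> i\<close> are replaced by
  \<open>m i \<in> M\<close>. The conclusion bounds the distance of a point \<open>t\<close> from the range of a linear operator
  \<open>T\<close>, and a functional separating them annihilates \<open>T\<close>, which evaluating the \<open>\<phi> i\<close> refutes.
\<close>

lemma Helly_bidual:
  fixes M :: "'b::real_normed_vector set"
    and \<phi> :: "'i \<Rightarrow> ('b \<Rightarrow> real) \<Rightarrow> real" and a :: "'l \<Rightarrow> 'i \<Rightarrow> real" and y :: "'l \<Rightarrow> 'i \<Rightarrow> 'b \<Rightarrow> real"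
  assumes M: "subspace M" and I: "finite I" and A: "finite A"
    and \<phi>: "\<And>i. i \<in> I \<Longrightarrow> linear_on_subspace (dual_on M) (\<phi> i)"
    and y: "\<And>l i. l \<in> A \<Longrightarrow> i \<in> I \<Longrightarrow> y l i \<in> dual_on M"
    and \<rho>: "\<And>l. l \<in> A \<Longrightarrow> 0 \<le> \<rho> l" "\<And>l. l \<in> A \<Longrightarrow> \<rho> l < R l"
    and bound: "\<And>l \<psi> K. l \<in> A \<Longrightarrow> \<psi> \<in> dual_on M \<Longrightarrow> 0 \<le> K \<Longrightarrow>
      (\<And>f. f \<in> M \<Longrightarrow> \<bar>\<psi> f\<bar> \<le> K * norm f) \<Longrightarrow> \<bar>\<Sum>i\<in>I. a l i * \<phi> i \<psi>\<bar> \<le> \<rho> l * K"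
  shows "\<exists>m. (\<forall>i\<in>I. m i \<in> M) \<and> (\<forall>l\<in>A. norm (\<Sum>i\<in>I. a l i *\<^sub>R m i) \<le> R l \<and>
    \<bar>(\<Sum>i\<in>I. y l i (m i)) - (\<Sum>i\<in>I. \<phi> i (y l i))\<bar> \<le> R l)"
proof (rule ccontr)
  assume no: "\<not> ?thesis"
  have R: "0 < R l" if "l \<in> A" for l using \<rho> that by fastforce
  \<comment> \<open>\<open>p u \<le> 1\<close> says that each coordinate in \<open>A\<close> stays
    within its tolerance \<open>R l\<close>. Inserting 0 keeps the maximum defined when
    \<open>A\<close> is empty.\<close>
  define p :: "('l \<Rightarrow> 'b \<times> real) \<Rightarrow> real"
    where "p u = Max (insert 0 ((\<lambda>l. norm (u l) / R l) ` A))" for u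
  have p_le: "p u \<le> c \<longleftrightarrow> 0 \<le> c \<and> (\<forall>l\<in>A. norm (u l) \<le> c * R l)" for u c
    using A R by (auto simp: p_def field_simps)
  have p_ge: "0 \<le> p u" "l \<in> A \<Longrightarrow> norm (u l) \<le> p u * R l" for u l
    using p_le[of u "p u"] by auto
  have p: "sublinear_on UNIV p"
  proof (rule sublinear_onI)
    fix u w :: "'l \<Rightarrow> 'b \<times> real"
    show "p (u + w) \<le> p u + p w"
      using p_ge by (auto simp: p_le distrib_right intro: norm_triangle_mono)
    fix r :: real assume "0 < r"
    then show "p (r *\<^sub>R u) \<le> r * p u"
      using p_ge by (auto simp: p_le mult.assoc)
  next
    show "p 0 = 0" using p_le[of 0 0] p_ge(1)[of 0] by simp
  qed simp
  \<comment> \<open>A solution of the system arises as \<open>- m\<close> from any \<open>m\<close>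
    with \<open>p (t + T m) \<le> 1\<close>. Hence, if there is none, \<open>t\<close> has
    \<open>p\<close>-distance at least 1 from the range of \<open>T\<close> on
    \<open>N\<close>.\<close>
  define N where "N = {m :: 'i \<Rightarrow> 'b. \<forall>i\<in>I. m i \<in> M}"
  define T where "T m = (\<lambda>l. if l \<in> A then (\<Sum>i\<in>I. a l i *\<^sub>R m i, \<Sum>i\<in>I. y l i (m i)) else 0)"
    for m :: "'i \<Rightarrow> 'b"
  define t where "t = (\<lambda>l. if l \<in> A then (0 :: 'b, \<Sum>i\<in>I. \<phi> i (y l i)) else 0)"
  have N: "subspace N"
    using M by (auto simp: N_def subspace_def)
  have y_lin: "linear_on_subspace M (y l i)" if "l \<in> A" "i \<in> I" for l i
    using y[OF that] by (simp add: dual_on_def)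
  have T_add: "T (m + m') = T m + T m'" if "m \<in> N" "m' \<in> N" for m m'
    using that linear_on_subspaceD(1)[OF y_lin]
    by (auto simp: T_def N_def fun_eq_iff scaleR_add_right sum.distrib)
  have T_scale: "T (r *\<^sub>R m) = r *\<^sub>R T m" if "m \<in> N" for m r
    using that linear_on_subspaceD(2)[OF y_lin]
    by (auto simp: T_def N_def fun_eq_iff scaleR_sum_right sum_distrib_left mult.commute)
  interpret C: minorised_cone UNIV "T ` N" p "\<lambda>_. 0"
  proof
    show "0 \<in> T ` N"
      using T_scale[of 0 0] subspace_0[OF N] by (metis image_eqI scale_zero_left)
    show "x + y \<in> T ` N" if "x \<in> T ` N" "y \<in> T ` N" for x y
      using that T_add subspace_add[OF N] by (metis (no_types, lifting) image_iff)
    show "r *\<^sub>R x \<in> T ` N" if "0 \<le> r" "x \<in> T ` N" for r x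
      using that T_scale subspace_scale[OF N] by (metis (no_types, lifting) image_iff)
  qed (use p p_ge in auto)
  \<comment> \<open>Infimal convolution with 0 on a subspace is the distance from it. A functional
    supporting this distance at \<open>t\<close> vanishes on the subspace and is at least 1 at
    \<open>t\<close>.\<close>
  obtain L where L: "linear_on_subspace UNIV L"
    and L_le: "\<And>u. L u \<le> infconv (T ` N) (\<lambda>_. 0) p u"
    and Lt: "L t = infconv (T ` N) (\<lambda>_. 0) p t"
    using supporting_functional_exists[OF _ C.sublinear_on_infconv, of t] by auto
  have L_p: "L u \<le> p u" for u
    using L_le[of u] C.infconv_le_self[of u] by simp
  note L_add = linear_on_subspaceD(1)[OF L UNIV_I UNIV_I]
    and L_scale = linear_on_subspaceD(2)[OF L UNIV_I]
  have LT_le: "L (- T m) \<le> 0" if "m \<in> N" for m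
    using L_le[of "- T m"] C.infconv_neg_le[of "T m"] that by force
  have LT: "L (T m) = 0" if "m \<in> N" for m
    using LT_le[OF that] LT_le[OF subspace_neg[OF N that]] L_scale[of "-1" "T m"] T_scale[OF that, of "-1"]
    by simp
  have Lt_ge: "1 \<le> L t"
    unfolding Lt
  proof (rule C.le_infconv)
    fix s assume "s \<in> T ` N"
    then obtain m where m: "m \<in> N" "s = T m" by auto
    show "1 \<le> p (t + s) - 0"
    proof (rule ccontr)
      assume "\<not> ?thesis"
      then have "p (t + T m) \<le> 1" using m by simp
      then have le: "norm ((t + T m) l) \<le> R l" if "l \<in> A" for l using that by (auto simp: p_le)
      have "norm (\<Sum>i\<in>I. a l i *\<^sub>R (- m) i) \<le> R l \<and>
        \<bar>(\<Sum>i\<in>I. y l i ((- m) i)) - (\<Sum>i\<in>I. \<phi> i (y l i))\<bar> \<le> R l" if l: "l \<in> A" for l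
      proof -
        have "y l i ((- m) i) = - y l i (m i)" if "i \<in> I" for i
          using linear_on_subspaceD(2)[OF y_lin[OF l that], of "m i" "-1"] m that by (simp add: N_def)
        then have eq: "(\<Sum>i\<in>I. y l i ((- m) i)) = - (\<Sum>i\<in>I. y l i (m i))"
          by (simp add: sum_negf)
        \<comment> \<open>The product norm dominates both components, so one tolerance controls the
          norm and the value together.\<close>
        show ?thesis
          using le[OF l] l norm_fst_le[of "fst ((t + T m) l)" "snd ((t + T m) l)"]
            norm_snd_le[of "snd ((t + T m) l)" "fst ((t + T m) l)"]
          unfolding eq by (auto simp: t_def T_def sum_negf abs_minus_commute add.commute)
      qed
      moreover have "\<forall>i\<in>I. (- m) i \<in> M" using subspace_neg[OF N m(1)] by (simp add: N_def)
      ultimately show False using no by blast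
    qed
  qed
  define single :: "'l \<Rightarrow> 'b \<times> real \<Rightarrow> 'l \<Rightarrow> 'b \<times> real"
    where "single l c = (\<lambda>l'. if l' = l then c else 0)" for l c
  have L_single: "L u = (\<Sum>l\<in>A. L (single l (u l)))" if "\<And>l. l \<notin> A \<Longrightarrow> u l = 0" for u
  proof -
    have "u = (\<Sum>l\<in>A. single l (u l))"
      using A that by (auto simp: fun_eq_iff sum_fun_apply single_def)
    then have "L u = L (\<Sum>l\<in>A. single l (u l))" by simp
    also have "\<dots> = (\<Sum>l\<in>A. L (single l (u l)))"
      by (rule linear_on_subspace_sum[OF L]) auto
    finally show ?thesis .
  qed
  \<comment> \<open>At coordinate \<open>l\<close> the functional \<open>L\<close> splits into a
    functional \<open>\<psi> l\<close> on \<open>M\<close> and a number \<open>c l\<close>; the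
    cut-off outside \<open>M\<close> places \<open>\<psi> l\<close> in
    \<open>dual_on M\<close>.\<close>
  define \<psi> where "\<psi> l f = (if f \<in> M then L (single l (f, 0)) else 0)" for l f
  define c where "c l = L (single l (0, 1))" for l
  have single_split: "L (single l (f, r)) = \<psi> l f + r * c l" if "f \<in> M" for l f r
  proof -
    have "single l (f, r) = single l (f, 0) + r *\<^sub>R single l (0, 1)"
      by (auto simp: single_def fun_eq_iff)
    then show ?thesis using that by (simp add: L_add L_scale \<psi>_def c_def)
  qed
  have \<psi>_lin: "linear_on_subspace M (\<psi> l)" for l
  proof -
    have "single l (f + g, 0) = single l (f, 0) + single l (g, 0)" for f g
      by (auto simp: single_def fun_eq_iff)
    moreover have "single l (r *\<^sub>R f, 0) = r *\<^sub>R single l (f, 0)" for r f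
      by (auto simp: single_def fun_eq_iff)
    ultimately show ?thesis
      using M by (auto simp: linear_on_subspace_def \<psi>_def subspace_add subspace_scale L_add L_scale)
  qed
  have \<psi>_neg: "\<psi> l (- f) = - \<psi> l f" if "f \<in> M" for l f
    using linear_on_subspaceD(2)[OF \<psi>_lin that, of l "-1"] by simp
  have \<psi>_le: "\<psi> l f \<le> norm f / R l" if "l \<in> A" "f \<in> M" for l f
  proof -
    have "p (single l (f, 0)) \<le> norm f / R l"
      using that R less_imp_le[OF R] by (auto simp: p_le single_def field_simps)
    then show ?thesis using L_p[of "single l (f, 0)"] that by (simp add: \<psi>_def)
  qed
  define U where "U = {f \<in> M. norm f \<le> 1}"
  \<comment> \<open>For \<open>l\<close> in \<open>A\<close> this is the norm of
    \<open>\<psi> l\<close> as a functional on \<open>M\<close>.\<close>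
  define K where "K l = (SUP f\<in>U. \<psi> l f)" for l
  have U0: "0 \<in> U" using M by (simp add: U_def subspace_0)
  have bdd: "bdd_above (\<psi> l ` U)" if "l \<in> A" for l
  proof (rule bdd_aboveI2)
    fix f assume f: "f \<in> U"
    then have "\<psi> l f \<le> norm f / R l" using \<psi>_le that by (simp add: U_def)
    also have "\<dots> \<le> 1 / R l" using f R[OF that] by (intro divide_right_mono) (auto simp: U_def)
    finally show "\<psi> l f \<le> 1 / R l" .
  qed
  have K_ge: "\<psi> l f \<le> K l" if "l \<in> A" "f \<in> U" for l f
    unfolding K_def using that by (intro cSUP_upper bdd)
  have K0: "0 \<le> K l" if "l \<in> A" for l
    using K_ge[OF that U0] linear_on_subspace_zero[OF \<psi>_lin M] by simp
  have \<psi>_K: "\<psi> l f \<le> K l * norm f" if "l \<in> A" "f \<in> M" for l f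
  proof (cases "f = 0")
    case True
    then show ?thesis using linear_on_subspace_zero[OF \<psi>_lin M] by simp
  next
    case False
    then have "inverse (norm f) *\<^sub>R f \<in> U" using that M by (simp add: U_def subspace_scale)
    from K_ge[OF that(1) this] show ?thesis
      using False linear_on_subspaceD(2)[OF \<psi>_lin that(2)] by (simp add: field_simps)
  qed
  then have \<psi>_abs: "\<bar>\<psi> l f\<bar> \<le> K l * norm f" if "l \<in> A" "f \<in> M" for l f
    using that \<psi>_neg[of f l] \<psi>_K[of l "- f"] subspace_neg[OF M] by (simp add: abs_le_iff)
  have \<psi>_dual: "\<psi> l \<in> dual_on M" if "l \<in> A" for l
    using \<psi>_lin \<psi>_abs[OF that] unfolding dual_on_def by (auto simp: \<psi>_def)
  \<comment> \<open>The dual estimate for the gauge \<open>p\<close>: test \<open>L\<close> on the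
    vector whose coordinates are \<open>R l\<close> times a near-maximiser of
    \<open>\<psi> l\<close>; its \<open>p\<close>-value is at most 1. The slack \<open>d\<close> per
    coordinate is chosen to add up to at most \<open>e\<close>.\<close>
  have RK: "(\<Sum>l\<in>A. R l * K l) \<le> 1"
  proof (rule field_le_epsilon)
    fix e :: real assume e: "0 < e"
    define s where "s = (\<Sum>l\<in>A. R l)"
    have s: "0 \<le> s" unfolding s_def using R by (intro sum_nonneg) (auto simp: less_imp_le)
    define d where "d = e / (s + 1)"
    have d: "0 < d" "d * s \<le> e" using e s by (auto simp: d_def field_simps)
    have "\<exists>f\<in>U. K l - d < \<psi> l f" if "l \<in> A" for l
      using less_cSUP_iff[OF _ bdd[OF that], of "K l - d"] U0 d by (auto simp: K_def)
    then obtain f where f: "\<And>l. l \<in> A \<Longrightarrow> f l \<in> U" "\<And>l. l \<in> A \<Longrightarrow> K l - d < \<psi> l (f l)"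
      by metis
    define u where "u l = (if l \<in> A then (R l *\<^sub>R f l, 0 :: real) else 0)" for l
    have "L u = (\<Sum>l\<in>A. R l * \<psi> l (f l))"
    proof -
      have "L (single l (u l)) = R l * \<psi> l (f l)" if "l \<in> A" for l
        using that f(1)[OF that] single_split[of "R l *\<^sub>R f l" l 0] linear_on_subspaceD(2)[OF \<psi>_lin] M
        by (simp add: u_def U_def subspace_scale)
      then show ?thesis by (subst L_single) (auto simp: u_def)
    qed
    moreover have "p u \<le> 1"
      using f(1) R by (auto simp: p_le u_def U_def less_imp_le mult_left_le)
    ultimately have "(\<Sum>l\<in>A. R l * \<psi> l (f l)) \<le> 1" using L_p[of u] by simp
    moreover have "(\<Sum>l\<in>A. R l * (K l - d)) \<le> (\<Sum>l\<in>A. R l * \<psi> l (f l))"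
      using f(2) R by (intro sum_mono mult_left_mono) (auto simp: less_imp_le)
    moreover have "(\<Sum>l\<in>A. R l * (K l - d)) = (\<Sum>l\<in>A. R l * K l) - d * s"
      by (simp add: right_diff_distrib sum_subtractf s_def sum_distrib_left mult.commute)
    ultimately show "(\<Sum>l\<in>A. R l * K l) \<le> 1 + e" using d by linarith
  qed
  \<comment> \<open>That \<open>L\<close> annihilates \<open>T\<close> is, for each
    \<open>i\<close>, a linear relation between the \<open>\<psi> l\<close> and the
    \<open>y l i\<close> inside \<open>dual_on M\<close>. The linear map \<open>\<phi> i\<close>
    preserves it.\<close>
  have vanish: "(\<Sum>l\<in>A. a l i * \<phi> i (\<psi> l)) + (\<Sum>l\<in>A. c l * \<phi> i (y l i)) = 0" if i: "i \<in> I" for i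
  proof -
    have "(\<Sum>l\<in>A. a l i *\<^sub>R \<psi> l) + (\<Sum>l\<in>A. c l *\<^sub>R y l i) = 0" (is "?s = 0")
    proof
      fix f
      show "?s f = 0 f"
      proof (cases "f \<in> M")
        case False
        then show ?thesis using y[OF _ i] by (auto simp: sum_fun_apply \<psi>_def dual_on_def)
      next
        case True
        define m where "m = (\<lambda>j. if j = i then f else 0)"
        have mN: "m \<in> N" using True M by (simp add: N_def m_def subspace_0)
        have Tm: "T m l = (a l i *\<^sub>R f, y l i f)" if l: "l \<in> A" for l
        proof -
          have "(\<Sum>j\<in>I. a l j *\<^sub>R m j) = (\<Sum>j\<in>I. if j = i then a l i *\<^sub>R f else 0)"
            by (rule sum.cong) (auto simp: m_def)
          moreover have "(\<Sum>j\<in>I. y l j (m j)) = (\<Sum>j\<in>I. if j = i then y l i f else 0)"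
            using linear_on_subspace_zero[OF y_lin[OF l] M] by (intro sum.cong) (auto simp: m_def)
          ultimately show ?thesis using l i I by (simp add: T_def)
        qed
        have "0 = L (T m)" using LT[OF mN] by simp
        also have "\<dots> = (\<Sum>l\<in>A. L (single l (T m l)))"
          by (rule L_single) (simp add: T_def)
        also have "\<dots> = (\<Sum>l\<in>A. a l i * \<psi> l f + y l i f * c l)"
          using True M linear_on_subspaceD(2)[OF \<psi>_lin True]
          by (intro sum.cong) (auto simp: Tm single_split subspace_scale)
        finally show ?thesis by (simp add: sum_fun_apply sum.distrib mult.commute)
      qed
    qed
    then have "0 = \<phi> i ?s"
      using linear_on_subspace_zero[OF \<phi>[OF i] subspace_dual_on] by simp
    also have "\<dots> = (\<Sum>l\<in>A. a l i * \<phi> i (\<psi> l)) + (\<Sum>l\<in>A. c l * \<phi> i (y l i))"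
      using \<psi>_dual y[OF _ i] subspace_dual_on[of M]
      by (simp add: linear_on_subspaceD(1)[OF \<phi>[OF i]] linear_on_subspace_sum[OF \<phi>[OF i] subspace_dual_on]
          linear_on_subspaceD(2)[OF \<phi>[OF i]] subspace_sum subspace_scale)
    finally show ?thesis by simp
  qed
  have "L t = (\<Sum>l\<in>A. (\<Sum>i\<in>I. \<phi> i (y l i)) * c l)"
    using single_split[OF subspace_0[OF M]] linear_on_subspace_zero[OF \<psi>_lin M]
    by (subst L_single) (auto simp: t_def)
  also have "\<dots> = (\<Sum>i\<in>I. \<Sum>l\<in>A. c l * \<phi> i (y l i))"
    by (subst sum.swap) (simp add: sum_distrib_left sum_distrib_right mult.commute)
  also have "\<dots> = (\<Sum>i\<in>I. - (\<Sum>l\<in>A. a l i * \<phi> i (\<psi> l)))"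
    using vanish by (intro sum.cong) (auto simp: eq_neg_iff_add_eq_0 add.commute)
  also have "\<dots> = - (\<Sum>l\<in>A. \<Sum>i\<in>I. a l i * \<phi> i (\<psi> l))"
    by (subst sum.swap) (simp add: sum_negf)
  also have "\<dots> \<le> (\<Sum>l\<in>A. \<bar>\<Sum>i\<in>I. a l i * \<phi> i (\<psi> l)\<bar>)"
    using sum_abs[of "\<lambda>l. \<Sum>i\<in>I. a l i * \<phi> i (\<psi> l)" A] by linarith
  also have "\<dots> \<le> (\<Sum>l\<in>A. \<rho> l * K l)"
    using bound \<psi>_dual K0 \<psi>_abs by (intro sum_mono) blast
  finally have ge: "1 \<le> (\<Sum>l\<in>A. \<rho> l * K l)" using Lt_ge by simp
  \<comment> \<open>The strict inequalities \<open>\<rho> l < R l\<close> decide here: nonnegative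
    terms with a nonpositive sum vanish, so every \<open>K l\<close> is 0, against
    \<open>ge\<close>.\<close>
  have "(\<Sum>l\<in>A. (R l - \<rho> l) * K l) \<le> 0"
    using ge RK by (simp add: left_diff_distrib sum_subtractf)
  moreover have nn: "0 \<le> (R l - \<rho> l) * K l" if "l \<in> A" for l
    using that \<rho> K0 by (simp add: less_imp_le)
  ultimately have "\<forall>l\<in>A. (R l - \<rho> l) * K l = 0"
    using sum_nonneg_eq_0_iff[of A "\<lambda>l. (R l - \<rho> l) * K l"] sum_nonneg[of A "\<lambda>l. (R l - \<rho> l) * K l"] A
    by (metis (no_types, lifting) antisym)
  then have "\<forall>l\<in>A. K l = 0" using \<rho>(2) by fastforce
  then show False using ge by simp
qed

section \<open>Finite-rank operators\<close>

lemma norming_functional_exists: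
  fixes x :: "'a::real_normed_vector"
  obtains g :: "'a \<Rightarrow>\<^sub>L real" where "norm g \<le> 1" "g x = norm x"
proof -
  have "sublinear_on UNIV (norm :: 'a \<Rightarrow> real)"
    by (rule sublinear_onI) (auto intro: norm_triangle_ineq)
  then obtain L :: "'a \<Rightarrow> real" where L: "linear_on_subspace UNIV L" "\<And>y. L y \<le> norm y" "L x = norm x"
    using supporting_functional_exists[of UNIV norm x] by auto
  have abs: "\<bar>L y\<bar> \<le> norm y" for y
    using L(2)[of y] L(2)[of "- y"] linear_on_subspaceD(2)[OF L(1), of y "-1"] by (simp add: abs_le_iff)
  have "bounded_linear L"
    using abs by (intro bounded_linear_intro[of _ 1])
      (auto simp: linear_on_subspaceD[OF L(1)])
  then have "blinfun_apply (Blinfun L) = L" by (rule bounded_linear_Blinfun_apply)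
  then show thesis
    using abs L(3) by (intro that[of "Blinfun L"] norm_blinfun_bound) auto
qed

text \<open>The coordinate functionals of a finite-dimensional span have to be bounded on the whole
  space. They are therefore built from Hahn-Banach functionals, one new basis vector at a
  time.\<close>

lemma biorthogonal_exists:
  fixes B :: "'a::real_normed_vector set"
  assumes "finite B" "independent B"
  shows "\<exists>g :: 'a \<Rightarrow> 'a \<Rightarrow>\<^sub>L real. (\<forall>b\<in>B. \<forall>b'\<in>B. g b b' = (if b = b' then 1 else 0)) \<and>
    (\<forall>x\<in>span B. x = (\<Sum>b\<in>B. g b x *\<^sub>R b))"
  using assms
proof (induction B rule: finite_induct)
  case empty
  then show ?case by simp
next
  case (insert a B)
  then have "independent B" "a \<notin> span B" by (simp_all add: independent_insert)
  with insert obtain g :: "'a \<Rightarrow> 'a \<Rightarrow>\<^sub>L real"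
    where g: "\<And>b b'. b \<in> B \<Longrightarrow> b' \<in> B \<Longrightarrow> g b b' = (if b = b' then 1 else 0)" by blast
  define y where "y = a - (\<Sum>b\<in>B. g b a *\<^sub>R b)"
  have "(\<Sum>b\<in>B. g b a *\<^sub>R b) \<in> span B" by (intro span_sum span_scale span_base)
  then have "y \<noteq> 0" using \<open>a \<notin> span B\<close> by (auto simp: y_def)
  moreover obtain h :: "'a \<Rightarrow>\<^sub>L real" where "h y = norm y" using norming_functional_exists .
  ultimately have hy: "h y \<noteq> 0" by simp
  \<comment> \<open>\<open>h\<close> is corrected to vanish on \<open>B\<close>; the corrected
    functional takes the value \<open>h y\<close> at \<open>a\<close>, which the factor normalises
    to 1.\<close>
  define k where "k = (1 / h y) *\<^sub>R (h - (\<Sum>b\<in>B. h b *\<^sub>R g b))"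
  have k: "k x = (h x - (\<Sum>b\<in>B. h b * g b x)) / h y" for x
    by (simp add: k_def blinfun.bilinear_simps blinfun.sum_left)
  have kB: "k b' = 0" if "b' \<in> B" for b'
  proof -
    have "(\<Sum>b\<in>B. h b * g b b') = (\<Sum>b\<in>B. if b = b' then h b else 0)"
      using g that by (intro sum.cong) auto
    then show ?thesis using insert(1) that by (simp add: k)
  qed
  have "k a = 1"
    using hy unfolding k by (simp add: y_def blinfun.bilinear_simps blinfun.sum_right mult.commute)
  define g' where "g' b = (if b = a then k else g b - g b a *\<^sub>R k)" for b
  have g': "g' b b' = (if b = b' then 1 else 0)" if "b \<in> insert a B" "b' \<in> insert a B" for b b'
    using that g insert(2) \<open>k a = 1\<close> kB by (auto simp: g'_def blinfun.bilinear_simps)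
  have "subspace {x. x = (\<Sum>b\<in>insert a B. g' b x *\<^sub>R b)}" (is "subspace ?V")
  proof (rule subspaceI)
    fix x and r :: real assume "x \<in> ?V"
    then have "r *\<^sub>R x = r *\<^sub>R (\<Sum>b\<in>insert a B. g' b x *\<^sub>R b)" by simp
    also have "\<dots> = (\<Sum>b\<in>insert a B. g' b (r *\<^sub>R x) *\<^sub>R b)"
      by (simp only: scaleR_sum_right scaleR_scaleR blinfun.scaleR_right real_scaleR_def)
    finally show "r *\<^sub>R x \<in> ?V" by blast
  qed (auto simp: blinfun.bilinear_simps scaleR_add_left sum.distrib)
  moreover have "insert a B \<subseteq> ?V"
  proof
    fix b' assume b': "b' \<in> insert a B"
    have "(\<Sum>b\<in>insert a B. g' b b' *\<^sub>R b) = (\<Sum>b\<in>insert a B. if b = b' then b else 0)"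
      using g' b' by (intro sum.cong) auto
    also have "\<dots> = b'" using insert(1) b' by (simp add: sum.delta)
    finally show "b' \<in> ?V" by simp
  qed
  ultimately have "span (insert a B) \<subseteq> ?V" by (intro span_minimal)
  then show ?case using g' by (intro exI[of _ g'] conjI ballI) auto
qed

lemma finite_rank_representation:
  fixes v :: "'a::real_normed_vector \<Rightarrow>\<^sub>L 'b::real_normed_vector"
  assumes "finite_rank v"
  obtains B and f :: "'b \<Rightarrow> 'a \<Rightarrow>\<^sub>L real" where "finite B" "\<And>x. v x = (\<Sum>b\<in>B. f b x *\<^sub>R b)"
proof -
  obtain B0 where B0: "finite B0" "range (blinfun_apply v) = span B0"
    using assms by (auto simp: finite_rank_def)
  obtain B where B: "B \<subseteq> B0" "independent B" "B0 \<subseteq> span B"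
    using maximal_independent_subset by blast
  have fin: "finite B" using B B0 finite_subset by blast
  have "v x \<in> span B" for x
    using B0 B(3) span_minimal[OF B(3) subspace_span] by blast
  moreover obtain g :: "'b \<Rightarrow> 'b \<Rightarrow>\<^sub>L real" where "\<forall>x\<in>span B. x = (\<Sum>b\<in>B. g b x *\<^sub>R b)"
    using biorthogonal_exists[OF fin B(2)] by blast
  ultimately have "v x = (\<Sum>b\<in>B. (g b o\<^sub>L v) x *\<^sub>R b)" for x by simp
  with fin show thesis using that[of B "\<lambda>b. g b o\<^sub>L v"] by blast
qed

lemma finite_rankI:
  fixes v :: "'a::real_normed_vector \<Rightarrow>\<^sub>L 'b::real_normed_vector"
  assumes "finite B" "\<And>x. v x \<in> span B"
  shows "finite_rank v"
proof -
  have sub: "subspace (range (blinfun_apply v))"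
    by (intro linear_subspace_image bounded_linear.linear blinfun.bounded_linear_right subspace_UNIV)
  obtain C where C: "C \<subseteq> range (blinfun_apply v)" "independent C" "range (blinfun_apply v) \<subseteq> span C"
    using maximal_independent_subset by blast
  have "finite C"
    using independent_span_bound[OF assms(1) C(2)] C(1) assms(2) by blast
  moreover have "range (blinfun_apply v) = span C"
    using C span_minimal[OF C(1) sub] by blast
  ultimately show ?thesis unfolding finite_rank_def by blast
qed

text \<open>Only the values on the finite set \<open>B\<close> matter. They are bounded, so rounding
  them down to multiples of \<open>d\<close> leaves finitely many patterns, and one functional for
  each pattern is enough.\<close>

lemma finite_net_of_functionals:
  fixes B :: "'a::real_normed_vector set"
  assumes B: "finite B" and d: "0 < d"
  obtains G :: "('a \<Rightarrow>\<^sub>L real) set" where "finite G" "\<And>g. g \<in> G \<Longrightarrow> norm g \<le> 1"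
    "\<And>g. norm g \<le> 1 \<Longrightarrow> \<exists>g'\<in>G. \<forall>b\<in>B. \<bar>blinfun_apply g b - blinfun_apply g' b\<bar> \<le> d"
proof -
  define h where "h g = (\<lambda>b\<in>B. \<lfloor>blinfun_apply g b / d\<rfloor>)" for g :: "'a \<Rightarrow>\<^sub>L real"
  let ?U = "{g :: 'a \<Rightarrow>\<^sub>L real. norm g \<le> 1}"
  have "h ` ?U \<subseteq> (\<Pi>\<^sub>E b\<in>B. {\<lfloor>- norm b / d\<rfloor>..\<lfloor>norm b / d\<rfloor>})"
  proof (intro image_subsetI PiE_I)
    fix g :: "'a \<Rightarrow>\<^sub>L real" and b assume g: "g \<in> ?U" and b: "b \<in> B"
    have "\<bar>g b\<bar> \<le> norm g * norm b" using norm_blinfun[of g b] by simp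
    also have "\<dots> \<le> 1 * norm b" using g by (intro mult_right_mono) auto
    finally have "- norm b / d \<le> g b / d" "g b / d \<le> norm b / d"
      using d divide_right_mono[of "- norm b" "g b" d] divide_right_mono[of "g b" "norm b" d]
      by (simp_all add: abs_le_iff)
    then show "h g b \<in> {\<lfloor>- norm b / d\<rfloor>..\<lfloor>norm b / d\<rfloor>}"
      using b by (auto simp: h_def intro!: floor_mono)
  qed (auto simp: h_def)
  then have "finite (h ` ?U)"
    by (rule finite_subset) (intro finite_PiE B finite_atLeastAtMost_int)
  then obtain G where G: "G \<subseteq> ?U" "finite G" "h ` ?U = h ` G"
    using finite_subset_image[of "h ` ?U" h ?U] by blast
  have "\<exists>g'\<in>G. \<forall>b\<in>B. \<bar>g b - g' b\<bar> \<le> d" if g: "norm g \<le> 1" for g :: "'a \<Rightarrow>\<^sub>L real"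
  proof -
    obtain g' where g': "g' \<in> G" "h g = h g'" using G g by blast
    have "\<bar>g b - g' b\<bar> \<le> d" if "b \<in> B" for b
    proof -
      have "\<lfloor>g b / d\<rfloor> = \<lfloor>g' b / d\<rfloor>" using fun_cong[OF g'(2), of b] that by (simp add: h_def)
      then have "\<bar>g b / d - g' b / d\<bar> \<le> 1" by linarith
      then have "\<bar>(g b - g' b) / d\<bar> \<le> 1" by (simp add: diff_divide_distrib)
      then show ?thesis using d by (simp add: abs_divide)
    qed
    then show ?thesis using g'(1) by blast
  qed
  then show thesis using that G by blast
qed

section \<open>Finite-rank approximation by operators whose adjoints map into
  \<open>M\<close>\<close>

definition eval_on :: "('a::real_normed_vector \<Rightarrow>\<^sub>L real) set \<Rightarrow> 'a \<Rightarrow> ('a \<Rightarrow>\<^sub>L real) \<Rightarrow> real" where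
  "eval_on M x = (\<lambda>f. if f \<in> M then blinfun_apply f x else 0)"

lemma eval_on_in_dual:
  assumes "subspace M"
  shows "eval_on M x \<in> dual_on M"
proof -
  have "\<bar>eval_on M x f\<bar> \<le> norm x * norm f" if "f \<in> M" for f
    using norm_blinfun[of f x] that by (simp add: eval_on_def mult.commute)
  then show ?thesis
    using assms by (auto simp: dual_on_def linear_on_subspace_def eval_on_def subspace_add
        subspace_scale blinfun.bilinear_simps)
qed

text \<open>A bounded operator \<open>e\<close> from \<open>X\<^sup>*\<close> to \<open>M\<^sup>*\<^sup>*\<close> lifting the restriction map along
  \<open>X \<rightarrow> M\<^sup>*\<close>.\<close>

locale bidual_lifting =
  fixes M :: "('a::banach \<Rightarrow>\<^sub>L real) set" and D :: real
    and e :: "('a \<Rightarrow>\<^sub>L real) \<Rightarrow> (('a \<Rightarrow>\<^sub>L real) \<Rightarrow> real) \<Rightarrow> real"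
  assumes M: "subspace M" and D: "0 \<le> D"
    and lin: "linear_on_subspace (dual_on M) (e f)"
    and add: "\<psi> \<in> dual_on M \<Longrightarrow> e (f + g) \<psi> = e f \<psi> + e g \<psi>"
    and scale: "\<psi> \<in> dual_on M \<Longrightarrow> e (r *\<^sub>R f) \<psi> = r * e f \<psi>"
    and bounded: "\<psi> \<in> dual_on M \<Longrightarrow> 0 \<le> K \<Longrightarrow> (\<And>g. g \<in> M \<Longrightarrow> \<bar>\<psi> g\<bar> \<le> K * norm g) \<Longrightarrow>
      \<bar>e f \<psi>\<bar> \<le> D * norm f * K"
    and lift: "e f (eval_on M x) = f x"
begin

lemma sum: "\<psi> \<in> dual_on M \<Longrightarrow> e (\<Sum>i\<in>I. r i *\<^sub>R f i) \<psi> = (\<Sum>i\<in>I. r i * e (f i) \<psi>)"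
  using scale[of \<psi> 0 0]
  by (induction I rule: infinite_finite_induct) (simp_all add: add scale)

text \<open>The operator \<open>w\<close> has coefficient functionals \<open>m b\<close> in
  \<open>M\<close>, so each \<open>g o\<^sub>L w\<close> is a combination of them and lies in
  \<open>M\<close>. Its norm is measured through these compositions, which is why the bound involves
  \<open>norm v\<close> and not the coefficients of a representation of \<open>v\<close>.\<close>

lemma finite_rank_approximation:
  fixes v :: "'a \<Rightarrow>\<^sub>L 'a"
  assumes v: "finite_rank v" and X: "finite X" and eps: "0 < \<epsilon>"
  obtains w :: "'a \<Rightarrow>\<^sub>L 'a"
  where "finite_rank w" "\<And>g. g o\<^sub>L w \<in> M" "norm w \<le> D * norm v + 1"
    "\<And>x. x \<in> X \<Longrightarrow> norm (w x - v x) \<le> \<epsilon>"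
proof -
  obtain B and f :: "'a \<Rightarrow> 'a \<Rightarrow>\<^sub>L real" where B: "finite B" and vf: "\<And>x. v x = (\<Sum>b\<in>B. f b x *\<^sub>R b)"
    using finite_rank_representation[OF v] by metis
  define S where "S = (\<Sum>b\<in>B. D * norm (f b) + 1)"
  have S: "0 \<le> S" unfolding S_def using D by (intro sum_nonneg) simp
  \<comment> \<open>\<open>S\<close> will bound the sum of the norms of the \<open>m b\<close>, so
    that moving from \<open>g\<close> to a net point costs at most
    \<open>\<delta> * S \<le> 1 / 2\<close>. The other half of the final \<open>+ 1\<close> is the
    slack between \<open>\<rho>\<close> and \<open>R\<close> on the net.\<close>
  define \<delta> where "\<delta> = 1 / (2 * (S + 1))"
  have \<delta>: "0 < \<delta>" "\<delta> * S \<le> 1 / 2" using S by (simp_all add: \<delta>_def field_simps)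
  define \<eta> where "\<eta> = \<epsilon> / ((\<Sum>b\<in>B. norm b) + 1)"
  have nB: "0 \<le> (\<Sum>b\<in>B. norm b)" by (intro sum_nonneg) simp
  then have \<eta>: "0 < \<eta>" "\<eta> * (\<Sum>b\<in>B. norm b) \<le> \<epsilon>" using eps by (simp_all add: \<eta>_def field_simps)
  obtain G :: "('a \<Rightarrow>\<^sub>L real) set" where G: "finite G" "\<And>g. g \<in> G \<Longrightarrow> norm g \<le> 1"
    and net: "\<And>g. norm g \<le> 1 \<Longrightarrow> \<exists>g'\<in>G. \<forall>b\<in>B. \<bar>blinfun_apply g b - blinfun_apply g' b\<bar> \<le> \<delta>"
    using finite_net_of_functionals[OF B \<delta>(1)] by metis
  \<comment> \<open>Three kinds of constraints: net functionals for the norm of \<open>w\<close>,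
    elements \<open>c\<close> of \<open>B\<close> for the norm of \<open>m c\<close>, pairs
    \<open>(c, x)\<close> for the value of \<open>m c\<close> at \<open>x\<close>. Each index uses
    one of the two inequalities of \<open>Helly_bidual\<close>; zero coefficients make the other
    trivial.\<close>
  define A where "A = G <+> B <+> B \<times> X"
  define a where "a l b = (case l of Inl g \<Rightarrow> blinfun_apply g b
      | Inr (Inl c) \<Rightarrow> if b = c then 1 else 0 | Inr (Inr _) \<Rightarrow> 0)"
    for l :: "('a \<Rightarrow>\<^sub>L real) + 'a + 'a \<times> 'a" and b
  define y where "y l b = (case l of Inr (Inr (c, x)) \<Rightarrow> if b = c then eval_on M x else 0 | _ \<Rightarrow> 0)"
    for l :: "('a \<Rightarrow>\<^sub>L real) + 'a + 'a \<times> 'a" and b :: 'a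
  define \<rho> where "\<rho> l = (case l of Inl g \<Rightarrow> D * norm v | Inr (Inl c) \<Rightarrow> D * norm (f c) | Inr (Inr _) \<Rightarrow> 0)"
    for l :: "('a \<Rightarrow>\<^sub>L real) + 'a + 'a \<times> 'a"
  define R where "R l = (case l of Inl g \<Rightarrow> D * norm v + 1 / 2
      | Inr (Inl c) \<Rightarrow> D * norm (f c) + 1 | Inr (Inr _) \<Rightarrow> \<eta>)"
    for l :: "('a \<Rightarrow>\<^sub>L real) + 'a + 'a \<times> 'a"
  have "\<exists>m. (\<forall>b\<in>B. m b \<in> M) \<and> (\<forall>l\<in>A. norm (\<Sum>b\<in>B. a l b *\<^sub>R m b) \<le> R l \<and>
      \<bar>(\<Sum>b\<in>B. y l b (m b)) - (\<Sum>b\<in>B. e (f b) (y l b))\<bar> \<le> R l)"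
  proof (rule Helly_bidual[OF M B, where \<rho> = \<rho>])
    show "finite A" unfolding A_def using G B X by (intro finite_Plus finite_cartesian_product)
    show "linear_on_subspace (dual_on M) (e (f b))" for b by (rule lin)
    show "y l b \<in> dual_on M" for l b
      using eval_on_in_dual[OF M] subspace_0[OF subspace_dual_on]
      by (auto simp: y_def split: sum.split)
    show "0 \<le> \<rho> l" for l using D by (auto simp: \<rho>_def split: sum.split)
    show "\<rho> l < R l" for l using \<eta>(1) by (auto simp: \<rho>_def R_def split: sum.split)
    fix l \<psi> K
    assume l: "l \<in> A" and \<psi>: "\<psi> \<in> dual_on M" and K: "0 \<le> K" "\<And>g. g \<in> M \<Longrightarrow> \<bar>\<psi> g\<bar> \<le> K * norm g"
    note bnd = bounded[OF \<psi> K]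
    from l consider g where "g \<in> G" "l = Inl g" | c where "c \<in> B" "l = Inr (Inl c)" | c where "l = Inr (Inr c)"
      unfolding A_def by blast
    then show "\<bar>\<Sum>b\<in>B. a l b * e (f b) \<psi>\<bar> \<le> \<rho> l * K"
    proof cases
      case 1
      \<comment> \<open>By linearity of \<open>e\<close> in its first argument the whole sum is
        \<open>e\<close> at a single functional, of norm at most \<open>norm v\<close>.\<close>
      have "(\<Sum>b\<in>B. g b *\<^sub>R f b) = g o\<^sub>L v"
        by (intro blinfun_eqI) (simp add: vf blinfun.bilinear_simps blinfun.sum_left blinfun.sum_right mult.commute)
      then have "(\<Sum>b\<in>B. a l b * e (f b) \<psi>) = e (g o\<^sub>L v) \<psi>"
        using sum[OF \<psi>, of "blinfun_apply g" f B] 1 by (simp add: a_def)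
      also have "\<bar>\<dots>\<bar> \<le> D * norm (g o\<^sub>L v) * K" by (rule bnd)
      also have "\<dots> \<le> D * norm v * K"
      proof (intro mult_right_mono mult_left_mono)
        have "norm (g o\<^sub>L v) \<le> norm g * norm v" by (rule norm_blinfun_compose)
        also have "\<dots> \<le> 1 * norm v" using G(2) 1 by (intro mult_right_mono) auto
        finally show "norm (g o\<^sub>L v) \<le> norm v" by simp
      qed (use D K in auto)
      finally show ?thesis using 1 by (simp add: \<rho>_def)
    next
      case 2
      have "(\<Sum>b\<in>B. a l b * e (f b) \<psi>) = (\<Sum>b\<in>B. if b = c then e (f b) \<psi> else 0)"
        using 2 by (intro sum.cong) (auto simp: a_def)
      also have "\<dots> = e (f c) \<psi>" using B 2 by simp
      finally show ?thesis using bnd[of "f c"] 2 by (simp add: \<rho>_def)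
    next
      case 3
      then show ?thesis by (simp add: a_def \<rho>_def)
    qed
  qed
  then obtain m where mM: "\<And>b. b \<in> B \<Longrightarrow> m b \<in> M"
    and m: "\<And>l. l \<in> A \<Longrightarrow> norm (\<Sum>b\<in>B. a l b *\<^sub>R m b) \<le> R l"
      "\<And>l. l \<in> A \<Longrightarrow> \<bar>(\<Sum>b\<in>B. y l b (m b)) - (\<Sum>b\<in>B. e (f b) (y l b))\<bar> \<le> R l"
    by blast
  have m_net: "norm (\<Sum>b\<in>B. g b *\<^sub>R m b) \<le> D * norm v + 1 / 2" if "g \<in> G" for g
    using m(1)[of "Inl g"] that by (simp add: A_def a_def R_def InlI)
  have m_norm: "norm (m c) \<le> D * norm (f c) + 1" if "c \<in> B" for c
  proof -
    have "(\<Sum>b\<in>B. a (Inr (Inl c)) b *\<^sub>R m b) = (\<Sum>b\<in>B. if b = c then m b else 0)"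
      by (intro sum.cong) (auto simp: a_def)
    then show ?thesis using m(1)[of "Inr (Inl c)"] that B by (simp add: A_def R_def InlI InrI)
  qed
  have m_close: "\<bar>m c x - f c x\<bar> \<le> \<eta>" if "c \<in> B" "x \<in> X" for c x
  proof -
    let ?l = "Inr (Inr (c, x)) :: ('a \<Rightarrow>\<^sub>L real) + 'a + 'a \<times> 'a"
    have "(\<Sum>b\<in>B. y ?l b (m b)) = (\<Sum>b\<in>B. if b = c then eval_on M x (m b) else 0)"
      by (intro sum.cong) (auto simp: y_def)
    moreover have "(\<Sum>b\<in>B. e (f b) (y ?l b)) = (\<Sum>b\<in>B. if b = c then e (f b) (eval_on M x) else 0)"
      using linear_on_subspace_zero[OF lin subspace_dual_on] by (intro sum.cong) (auto simp: y_def)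
    moreover have "eval_on M x (m c) = m c x" using mM that by (simp add: eval_on_def)
    ultimately show ?thesis using m(2)[of ?l] that B by (simp add: A_def R_def lift InrI)
  qed
  define w :: "'a \<Rightarrow>\<^sub>L 'a" where "w = (\<Sum>b\<in>B. blinfun_scaleR_left b o\<^sub>L m b)"
  have w: "w x = (\<Sum>b\<in>B. m b x *\<^sub>R b)" for x by (simp add: w_def blinfun.sum_left)
  have gw: "g o\<^sub>L w = (\<Sum>b\<in>B. g b *\<^sub>R m b)" for g :: "'a \<Rightarrow>\<^sub>L real"
    by (intro blinfun_eqI) (simp add: w blinfun.bilinear_simps blinfun.sum_left blinfun.sum_right mult.commute)
  show thesis
  proof (rule that)
    show "finite_rank w"
      by (rule finite_rankI[OF B]) (unfold w, intro span_sum span_scale span_base)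
    show "g o\<^sub>L w \<in> M" for g
      unfolding gw using M mM by (intro subspace_sum subspace_scale)
    show "norm w \<le> D * norm v + 1"
    proof (rule norm_blinfun_bound)
      show "0 \<le> D * norm v + 1" using D by simp
      fix x
      obtain g :: "'a \<Rightarrow>\<^sub>L real" where g: "norm g \<le> 1" "g (w x) = norm (w x)"
        using norming_functional_exists .
      obtain g' where g': "g' \<in> G" "\<And>b. b \<in> B \<Longrightarrow> \<bar>g b - g' b\<bar> \<le> \<delta>" using net[OF g(1)] by blast
      have "norm (\<Sum>b\<in>B. g b *\<^sub>R m b) \<le> D * norm v + 1"
      proof -
        have "(\<Sum>b\<in>B. g b *\<^sub>R m b) = (\<Sum>b\<in>B. g' b *\<^sub>R m b) + (\<Sum>b\<in>B. (g b - g' b) *\<^sub>R m b)"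
          by (simp add: scaleR_left_diff_distrib sum_subtractf)
        also have "norm \<dots> \<le> (D * norm v + 1 / 2) + \<delta> * S"
        proof (rule norm_triangle_mono[OF m_net[OF g'(1)]])
          have "norm (\<Sum>b\<in>B. (g b - g' b) *\<^sub>R m b) \<le> (\<Sum>b\<in>B. \<delta> * (D * norm (f b) + 1))"
            using g'(2) m_norm \<delta> by (intro sum_norm_le) (auto intro!: mult_mono)
          then show "norm (\<Sum>b\<in>B. (g b - g' b) *\<^sub>R m b) \<le> \<delta> * S" by (simp add: S_def sum_distrib_left)
        qed
        finally show ?thesis using \<delta> by simp
      qed
      then have "norm (g o\<^sub>L w) * norm x \<le> (D * norm v + 1) * norm x"
        unfolding gw by (intro mult_right_mono) auto
      then show "norm (w x) \<le> (D * norm v + 1) * norm x"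
        using norm_blinfun[of "g o\<^sub>L w" x] g(2) by simp
    qed
    show "norm (w x - v x) \<le> \<epsilon>" if x: "x \<in> X" for x
    proof -
      have "w x - v x = (\<Sum>b\<in>B. (m b x - f b x) *\<^sub>R b)"
        by (simp add: w vf scaleR_left_diff_distrib sum_subtractf)
      also have "norm \<dots> \<le> (\<Sum>b\<in>B. \<eta> * norm b)"
        using m_close[OF _ x] by (intro sum_norm_le) (auto intro!: mult_right_mono)
      also have "\<dots> \<le> \<epsilon>" using \<eta>(2) by (simp add: sum_distrib_left)
      finally show ?thesis .
    qed
  qed
qed

text \<open>\<open>w n\<close> is accurate up to \<open>2 * c n\<close> at the first
  \<open>n + 1\<close> points of a dense sequence: one \<open>c n\<close> comes from the
  approximation property, the other from replacing \<open>v\<close> by \<open>w\<close>. The bound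
  \<open>W\<close>, independent of \<open>n\<close>, carries the convergence to all points.\<close>

lemma quasibasic:
  assumes sep: "separable_space (euclidean :: 'a topology)" and bap: "BAP TYPE('a)"
  shows "quasibasic M"
proof -
  obtain C :: "'a set" where C: "countable C" "closure C = UNIV"
    using sep by (auto simp: separable_space_def)
  then have "C \<noteq> {}" by auto
  then obtain d :: "nat \<Rightarrow> 'a" where d: "range d = C"
    using range_from_nat_into[OF _ C(1)] by metis
  obtain l where l: "\<And>K \<epsilon>. compact K \<Longrightarrow> 0 < \<epsilon> \<Longrightarrow>
      \<exists>v :: 'a \<Rightarrow>\<^sub>L 'a. finite_rank v \<and> norm v \<le> l \<and> (\<forall>x\<in>K. norm (v x - x) < \<epsilon>)"
    using bap unfolding BAP_def by metis
  define c where "c n = 1 / real (Suc n)" for n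
  have c: "0 < c n" for n by (simp add: c_def)
  define W where "W = D * l + 1"
  have "\<exists>w :: 'a \<Rightarrow>\<^sub>L 'a. finite_rank w \<and> (\<forall>g. g o\<^sub>L w \<in> M) \<and> norm w \<le> W \<and>
      (\<forall>j\<le>n. norm (w (d j) - d j) \<le> 2 * c n)" for n
  proof -
    obtain v :: "'a \<Rightarrow>\<^sub>L 'a" where v: "finite_rank v" "norm v \<le> l" "\<And>j. j \<le> n \<Longrightarrow> norm (v (d j) - d j) < c n"
      using l[of "d ` {..n}" "c n"] c by (auto simp: finite_imp_compact)
    obtain w :: "'a \<Rightarrow>\<^sub>L 'a" where w: "finite_rank w" "\<And>g. g o\<^sub>L w \<in> M" "norm w \<le> D * norm v + 1"
      "\<And>x. x \<in> d ` {..n} \<Longrightarrow> norm (w x - v x) \<le> c n"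
      using finite_rank_approximation[OF v(1) _ c, of "d ` {..n}"] by blast
    have "norm w \<le> W" using w(3) mult_left_mono[OF v(2) D] by (simp add: W_def)
    moreover have "norm (w (d j) - d j) \<le> 2 * c n" if "j \<le> n" for j
      using norm_triangle_ineq[of "w (d j) - v (d j)" "v (d j) - d j"] v(3)[OF that] w(4)[of "d j"] that
      by simp
    ultimately show ?thesis using w by blast
  qed
  then obtain w :: "nat \<Rightarrow> 'a \<Rightarrow>\<^sub>L 'a" where w: "\<And>n. finite_rank (w n)" "\<And>n g. g o\<^sub>L w n \<in> M"
    "\<And>n. norm (w n) \<le> W" "\<And>n j. j \<le> n \<Longrightarrow> norm (w n (d j) - d j) \<le> 2 * c n"
    by metis
  have W: "0 \<le> W" using w(3)[of 0] norm_ge_zero order_trans by blast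
  have "(\<lambda>n. norm (w n x - x)) \<longlonglongrightarrow> 0" for x
  proof (rule LIMSEQ_I)
    fix r :: real assume r: "0 < r"
    \<comment> \<open>The factor \<open>W + 1\<close> accounts for both \<open>w n (x - d j)\<close>
      and \<open>d j - x\<close>.\<close>
    have "0 < r / (2 * (W + 1))" using r W by simp
    moreover have "x \<in> closure C" using C by simp
    ultimately obtain j where j: "dist (d j) x < r / (2 * (W + 1))"
      using d unfolding closure_approachable by blast
    have near: "(W + 1) * norm (x - d j) < r / 2"
      using j W by (simp add: dist_norm norm_minus_commute field_simps)
    have "c \<longlonglongrightarrow> 0" unfolding c_def using LIMSEQ_inverse_real_of_nat by (simp add: inverse_eq_divide)
    then obtain N where N: "\<And>n. N \<le> n \<Longrightarrow> norm (c n - 0) < r / 4"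
      using LIMSEQ_D[of c 0 "r / 4"] r by auto
    have "norm (norm (w n x - x) - 0) < r" if n: "max N j \<le> n" for n
    proof -
      have "w n x - x = w n (x - d j) + (w n (d j) - d j) + (d j - x)"
        by (simp add: blinfun.bilinear_simps)
      then have "norm (w n x - x) \<le> norm (w n (x - d j)) + norm (w n (d j) - d j) + norm (d j - x)"
        using norm_triangle_ineq[of "w n (x - d j) + (w n (d j) - d j)" "d j - x"]
          norm_triangle_ineq[of "w n (x - d j)" "w n (d j) - d j"] by simp
      moreover have "norm (w n (x - d j)) \<le> W * norm (x - d j)"
        using norm_blinfun[of "w n" "x - d j"] mult_right_mono[OF w(3)[of n] norm_ge_zero[of "x - d j"]]
        by linarith
      moreover have "norm (w n (d j) - d j) < r / 2" using w(4)[of j n] N[of n] n by simp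
      ultimately show ?thesis using near by (simp add: norm_minus_commute distrib_right)
    qed
    then show "\<exists>no. \<forall>n\<ge>no. norm (norm (w n x - x) - 0) < r" by blast
  qed
  then show ?thesis
    using w(1,2) by (auto simp: quasibasic_def blinfun_adjoint_def intro!: exI[of _ w])
qed

end

section \<open>Renorming the dual of a norming subspace\<close>

text \<open>
  The open unit ball is the convex hull of the open unit ball of \<open>X\<close> and \<open>1/C\<close> times that of \<open>M\<^sup>*\<close>.
  The dual norm itself would only make \<open>X \<rightarrow> M\<^sup>*\<close> an isomorphic embedding.
\<close>

definition renorm ::
  "('a::real_normed_vector \<Rightarrow>\<^sub>L real) set \<Rightarrow> real \<Rightarrow> (('a \<Rightarrow>\<^sub>L real) \<Rightarrow> real) \<Rightarrow> real" where
  "renorm M C \<phi> = Inf {norm x + C * K | x K.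
     0 \<le> K \<and> (\<forall>f\<in>M. \<bar>\<phi> f - blinfun_apply f x\<bar> \<le> K * norm f)}"

text \<open>The carrier is the copy of \<open>dual_on M\<close> in the second summand of
  \<open>univ\<close>, so the operations pass through \<open>projr\<close>.\<close>

definition renormed_dual ::
  "('a::real_normed_vector \<Rightarrow>\<^sub>L real) set \<Rightarrow> real \<Rightarrow> ('a, 'z) univ nspace" where
  "renormed_dual M C = \<lparr>carr = Inr ` dual_on M, vadd = (\<lambda>z w. Inr (projr z + projr w)),
     vzero = Inr 0, vscale = (\<lambda>r z. Inr (r *\<^sub>R projr z)), vnorm = (\<lambda>z. renorm M C (projr z))\<rparr>"

lemma renormed_dual_simps [simp]:
  "carr (renormed_dual M C) = Inr ` dual_on M"
  "vadd (renormed_dual M C) z w = Inr (projr z + projr w)"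
  "vzero (renormed_dual M C) = Inr 0"
  "vscale (renormed_dual M C) r z = Inr (r *\<^sub>R projr z)"
  "vnorm (renormed_dual M C) z = renorm M C (projr z)"
  by (simp_all add: renormed_dual_def)

lemmas dual_on_zero = subspace_0[OF subspace_dual_on]
  and dual_on_add = subspace_add[OF subspace_dual_on]
  and dual_on_scale = subspace_scale[OF subspace_dual_on]

lemma Inr_in_image_Inr: "Inr x \<in> Inr ` S \<longleftrightarrow> x \<in> S"
  by auto

lemma eval_on_add: "eval_on M (x + y) = eval_on M x + eval_on M y"
  by (auto simp: eval_on_def blinfun.bilinear_simps)

lemma eval_on_scale: "eval_on M (r *\<^sub>R x) = r *\<^sub>R eval_on M x"
  by (auto simp: eval_on_def blinfun.bilinear_simps)

text \<open>\<open>1 / c \<le> C\<close> makes the embedding of \<open>X\<close> isometric, and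
  \<open>1 \<le> C\<close> makes \<open>renorm\<close> dominate the dual norm on functionals on
  \<open>M\<close>. As \<open>renorm\<close> is also at most \<open>C\<close> times that norm, the
  two are equivalent.\<close>

locale norming_subspace =
  fixes M :: "('a::banach \<Rightarrow>\<^sub>L real) set" and c C :: real
  assumes M: "subspace M" and c: "0 < c" and C: "1 \<le> C" "1 / c \<le> C"
    and norming: "c * norm x \<le> (SUP f\<in>M. \<bar>blinfun_apply f x\<bar> / norm f)"
begin

abbreviation N :: "(('a \<Rightarrow>\<^sub>L real) \<Rightarrow> real) \<Rightarrow> real" where
  "N \<equiv> renorm M C"

lemma norm_le_of_bound:
  assumes "0 \<le> K" "\<And>f. f \<in> M \<Longrightarrow> \<bar>blinfun_apply f x\<bar> \<le> K * norm f"
  shows "norm x \<le> C * K"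
proof -
  have "(SUP f\<in>M. \<bar>blinfun_apply f x\<bar> / norm f) \<le> K"
  proof (rule cSUP_least)
    show "M \<noteq> {}" using subspace_0[OF M] by auto
    fix f assume "f \<in> M"
    then show "\<bar>blinfun_apply f x\<bar> / norm f \<le> K"
      using assms by (cases "f = 0") (auto simp: field_simps)
  qed
  then have "norm x \<le> 1 / c * K" using norming[of x] c by (simp add: field_simps)
  also have "\<dots> \<le> C * K" using C assms(1) by (intro mult_right_mono)
  finally show ?thesis .
qed

lemma renorm_le:
  assumes "0 \<le> K" "\<And>f. f \<in> M \<Longrightarrow> \<bar>\<phi> f - blinfun_apply f x\<bar> \<le> K * norm f"
  shows "N \<phi> \<le> norm x + C * K"
  unfolding renorm_def
proof (rule cInf_lower)
  show "bdd_below {norm x + C * K |x K. 0 \<le> K \<and> (\<forall>f\<in>M. \<bar>\<phi> f - blinfun_apply f x\<bar> \<le> K * norm f)}"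
    using C by (intro bdd_belowI[of _ 0]) auto
qed (use assms in blast)

lemma renorm_le_dual:
  assumes "0 \<le> K" "\<And>f. f \<in> M \<Longrightarrow> \<bar>\<phi> f\<bar> \<le> K * norm f"
  shows "N \<phi> \<le> C * K"
  using renorm_le[of K \<phi> 0] assms by simp

lemma le_renorm:
  assumes \<phi>: "\<phi> \<in> dual_on M"
    and le: "\<And>x K. 0 \<le> K \<Longrightarrow> (\<And>f. f \<in> M \<Longrightarrow> \<bar>\<phi> f - blinfun_apply f x\<bar> \<le> K * norm f) \<Longrightarrow> d \<le> norm x + C * K"
  shows "d \<le> N \<phi>"
  unfolding renorm_def
proof (rule cInf_greatest)
  obtain K where K: "\<And>f. f \<in> M \<Longrightarrow> \<bar>\<phi> f\<bar> \<le> K * norm f" using \<phi> unfolding dual_on_def by blast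
  have "\<bar>\<phi> f - blinfun_apply f 0\<bar> \<le> \<bar>K\<bar> * norm f" if "f \<in> M" for f
    using K[OF that] mult_right_mono[OF abs_ge_self[of K] norm_ge_zero[of f]] by simp
  then have "norm (0 :: 'a) + C * \<bar>K\<bar> \<in> {norm x + C * K |x K. 0 \<le> K \<and> (\<forall>f\<in>M. \<bar>\<phi> f - blinfun_apply f x\<bar> \<le> K * norm f)}"
    using abs_ge_zero[of K] by blast
  then show "{norm x + C * K |x K. 0 \<le> K \<and> (\<forall>f\<in>M. \<bar>\<phi> f - blinfun_apply f x\<bar> \<le> K * norm f)} \<noteq> {}" by blast
qed (use le in blast)

lemma renorm_nonneg: "\<phi> \<in> dual_on M \<Longrightarrow> 0 \<le> N \<phi>"
  using C by (intro le_renorm) auto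

lemma renorm_bound:
  assumes \<phi>: "\<phi> \<in> dual_on M" and f: "f \<in> M"
  shows "\<bar>\<phi> f\<bar> \<le> N \<phi> * norm f"
proof (cases "f = 0")
  case True
  have "\<phi> 0 = 0" using \<phi> linear_on_subspace_zero[OF _ M] by (simp add: dual_on_def)
  then show ?thesis using True by simp
next
  case False
  have "\<bar>\<phi> f\<bar> / norm f \<le> N \<phi>"
  proof (rule le_renorm[OF \<phi>])
    fix x K assume K: "0 \<le> K" "\<And>f. f \<in> M \<Longrightarrow> \<bar>\<phi> f - blinfun_apply f x\<bar> \<le> K * norm f"
    have "\<bar>\<phi> f\<bar> \<le> K * norm f + norm f * norm x"
      using K(2)[OF f] norm_blinfun[of f x] by simp
    also have "\<dots> = (norm x + 1 * K) * norm f" by (simp add: algebra_simps)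
    also have "\<dots> \<le> (norm x + C * K) * norm f"
      using C K(1) by (intro mult_right_mono add_left_mono) auto
    finally show "\<bar>\<phi> f\<bar> / norm f \<le> norm x + C * K" using False by (simp add: field_simps)
  qed
  then show ?thesis using False by (simp add: field_simps)
qed

text \<open>Taking \<open>x\<close> itself with remainder 0 gives one inequality. For a competitor
  \<open>y\<close> with remainder bound \<open>K\<close>, the norming property yields
  \<open>norm (x - y) \<le> C * K\<close>, so it is no cheaper.\<close>

lemma renorm_eval_on: "N (eval_on M x) = norm x"
proof (rule antisym)
  show "N (eval_on M x) \<le> norm x"
    using renorm_le[of 0 "eval_on M x" x] by (simp add: eval_on_def)
  show "norm x \<le> N (eval_on M x)"
  proof (rule le_renorm[OF eval_on_in_dual[OF M]])
    fix y K assume K: "0 \<le> K" "\<And>f. f \<in> M \<Longrightarrow> \<bar>eval_on M x f - blinfun_apply f y\<bar> \<le> K * norm f"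
    have "norm (x - y) \<le> C * K"
      using K by (intro norm_le_of_bound) (simp_all add: eval_on_def blinfun.bilinear_simps)
    then show "norm x \<le> norm y + C * K" using norm_triangle_ineq2[of x y] by simp
  qed
qed

lemma renorm_eq_zero:
  assumes \<phi>: "\<phi> \<in> dual_on M"
  shows "N \<phi> = 0 \<longleftrightarrow> \<phi> = 0"
proof
  assume "N \<phi> = 0"
  then have "\<phi> f = 0" for f
    using renorm_bound[OF \<phi>, of f] \<phi> by (cases "f \<in> M") (auto simp: dual_on_def)
  then show "\<phi> = 0" by auto
next
  assume "\<phi> = 0"
  then show "N \<phi> = 0"
    using renorm_le_dual[of 0 \<phi>] renorm_nonneg[OF \<phi>] by simp
qed

lemma renorm_triangle:
  assumes \<phi>: "\<phi> \<in> dual_on M" and \<psi>: "\<psi> \<in> dual_on M"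
  shows "N (\<phi> + \<psi>) \<le> N \<phi> + N \<psi>"
proof -
  have *: "N (\<phi> + \<psi>) \<le> (norm x + C * K) + (norm y + C * K')"
    if "0 \<le> K" "\<And>f. f \<in> M \<Longrightarrow> \<bar>\<phi> f - blinfun_apply f x\<bar> \<le> K * norm f"
      "0 \<le> K'" "\<And>f. f \<in> M \<Longrightarrow> \<bar>\<psi> f - blinfun_apply f y\<bar> \<le> K' * norm f" for x y K K'
  proof -
    have "N (\<phi> + \<psi>) \<le> norm (x + y) + C * (K + K')"
    proof (rule renorm_le)
      fix f assume f: "f \<in> M"
      show "\<bar>(\<phi> + \<psi>) f - blinfun_apply f (x + y)\<bar> \<le> (K + K') * norm f"
        using that(2)[OF f] that(4)[OF f] by (simp add: blinfun.bilinear_simps distrib_right)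
    qed (use that in simp)
    then show ?thesis using norm_triangle_ineq[of x y] by (simp add: distrib_left)
  qed
  have "N (\<phi> + \<psi>) - (norm y + C * K') \<le> N \<phi>"
    if "0 \<le> K'" "\<And>f. f \<in> M \<Longrightarrow> \<bar>\<psi> f - blinfun_apply f y\<bar> \<le> K' * norm f" for y K'
  proof (rule le_renorm[OF \<phi>])
    fix x K assume "0 \<le> K" "\<And>f. f \<in> M \<Longrightarrow> \<bar>\<phi> f - blinfun_apply f x\<bar> \<le> K * norm f"
    then show "N (\<phi> + \<psi>) - (norm y + C * K') \<le> norm x + C * K"
      using *[of K x K' y] that by simp
  qed
  then have "N (\<phi> + \<psi>) - N \<phi> \<le> N \<psi>"
    by (intro le_renorm[OF \<psi>]) (simp add: algebra_simps)
  then show ?thesis by simp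
qed

lemma renorm_scale:
  assumes \<phi>: "\<phi> \<in> dual_on M"
  shows "N (r *\<^sub>R \<phi>) = \<bar>r\<bar> * N \<phi>"
proof -
  have le: "N (r *\<^sub>R \<phi>) \<le> \<bar>r\<bar> * N \<phi>" if \<phi>: "\<phi> \<in> dual_on M" and r: "r \<noteq> 0" for \<phi> r
  proof -
    have "N (r *\<^sub>R \<phi>) / \<bar>r\<bar> \<le> N \<phi>"
    proof (rule le_renorm[OF \<phi>])
      fix x K assume K: "0 \<le> K" "\<And>f. f \<in> M \<Longrightarrow> \<bar>\<phi> f - blinfun_apply f x\<bar> \<le> K * norm f"
      have "N (r *\<^sub>R \<phi>) \<le> norm (r *\<^sub>R x) + C * (\<bar>r\<bar> * K)"
      proof (rule renorm_le)
        fix f assume f: "f \<in> M"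
        have "\<bar>(r *\<^sub>R \<phi>) f - blinfun_apply f (r *\<^sub>R x)\<bar> = \<bar>r\<bar> * \<bar>\<phi> f - blinfun_apply f x\<bar>"
          by (simp add: blinfun.bilinear_simps flip: abs_mult right_diff_distrib)
        also have "\<dots> \<le> \<bar>r\<bar> * (K * norm f)" using K(2)[OF f] by (intro mult_left_mono) auto
        finally show "\<bar>(r *\<^sub>R \<phi>) f - blinfun_apply f (r *\<^sub>R x)\<bar> \<le> \<bar>r\<bar> * K * norm f"
          by (simp add: mult.assoc)
      qed (use K in simp)
      then show "N (r *\<^sub>R \<phi>) / \<bar>r\<bar> \<le> norm x + C * K" using r by (simp add: field_simps)
    qed
    then show ?thesis using r by (simp add: field_simps)
  qed
  show ?thesis
  proof (cases "r = 0")
    case True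
    then show ?thesis using renorm_eq_zero[OF dual_on_zero] by simp
  next
    case False
    have "N (inverse r *\<^sub>R r *\<^sub>R \<phi>) \<le> \<bar>inverse r\<bar> * N (r *\<^sub>R \<phi>)"
      using False \<phi> by (intro le dual_on_scale) auto
    then have "\<bar>r\<bar> * N \<phi> \<le> N (r *\<^sub>R \<phi>)" using False by (simp add: field_simps)
    then show ?thesis using le[OF \<phi> False] by simp
  qed
qed

lemma normed_nspace_renormed_dual: "normed_nspace (renormed_dual M C :: ('a, 'z) univ nspace)"
  by (rule normed_nspace.intro)
    (auto simp: Inr_in_image_Inr dual_on_zero dual_on_add dual_on_scale scaleR_add_right
      scaleR_add_left ac_simps renorm_eq_zero renorm_triangle renorm_scale)

text \<open>This is the completeness of a dual space, with limits taken pointwise on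
  \<open>M\<close>; the equivalence of the two norms transports the Cauchy condition one way and the
  convergence back.\<close>

lemma banach_nspace_renormed_dual: "banach_nspace (renormed_dual M C :: ('a, 'z) univ nspace)"
proof -
  let ?Z = "renormed_dual M C :: ('a, 'z) univ nspace"
  interpret normed_nspace ?Z by (rule normed_nspace_renormed_dual)
  have sub: "\<phi> - \<psi> \<in> dual_on M" if "\<phi> \<in> dual_on M" "\<psi> \<in> dual_on M" for \<phi> \<psi>
    using that subspace_diff[OF subspace_dual_on] by blast
  have dist: "vdist ?Z (Inr \<phi>) (Inr \<psi>) = N (\<phi> - \<psi>)" for \<phi> \<psi>
    by (simp add: vdist_def)
  show ?thesis
  proof unfold_locales
    fix s :: "nat \<Rightarrow> ('a, 'z) univ"
    assume s: "\<And>n. s n \<in> carr ?Z"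
      and cauchy: "\<And>e. e > 0 \<Longrightarrow> \<exists>N. \<forall>m\<ge>N. \<forall>n\<ge>N. vdist ?Z (s m) (s n) < e"
    from s have "\<forall>n. \<exists>\<phi>\<in>dual_on M. s n = Inr \<phi>" by auto
    then obtain \<sigma> where \<sigma>: "\<And>n. \<sigma> n \<in> dual_on M" "\<And>n. s n = Inr (\<sigma> n)" by metis
    have \<sigma>_lin: "linear_on_subspace M (\<sigma> n)" for n using \<sigma>(1) by (simp add: dual_on_def)
    have close: "\<exists>n0. \<forall>m\<ge>n0. \<forall>n\<ge>n0. \<forall>f\<in>M. \<bar>\<sigma> m f - \<sigma> n f\<bar> \<le> e * norm f" if e: "e > 0" for e
    proof -
      obtain n0 where n0: "\<And>m n. m \<ge> n0 \<Longrightarrow> n \<ge> n0 \<Longrightarrow> N (\<sigma> m - \<sigma> n) < e"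
        using cauchy[OF e] by (auto simp: \<sigma>(2) dist)
      have "\<bar>\<sigma> m f - \<sigma> n f\<bar> \<le> e * norm f" if "m \<ge> n0" "n \<ge> n0" "f \<in> M" for m n f
        using renorm_bound[OF sub[OF \<sigma>(1) \<sigma>(1)] that(3), of m n] 
          mult_right_mono[OF less_imp_le[OF n0[OF that(1,2)]] norm_ge_zero[of f]]
        by simp
      then show ?thesis by blast
    qed
    have conv: "convergent (\<lambda>n. \<sigma> n f)" if f: "f \<in> M" for f
    proof (rule Cauchy_convergent, rule metric_CauchyI)
      fix e :: real assume e: "0 < e"
      then have "e / (norm f + 1) > 0" by (simp add: add_nonneg_pos)
      then obtain n0 where n0: "\<And>m n. m \<ge> n0 \<Longrightarrow> n \<ge> n0 \<Longrightarrow> \<bar>\<sigma> m f - \<sigma> n f\<bar> \<le> e / (norm f + 1) * norm f"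
        using close f by meson
      have "0 < norm f + 1" by (simp add: add_nonneg_pos)
      then have "e / (norm f + 1) * norm f < e"
        using e by (simp add: pos_divide_less_eq distrib_left)
      then show "\<exists>n0. \<forall>m\<ge>n0. \<forall>n\<ge>n0. dist (\<sigma> m f) (\<sigma> n f) < e"
        using n0 by (fastforce simp: dist_real_def)
    qed
    define \<phi> where "\<phi> f = (if f \<in> M then lim (\<lambda>n. \<sigma> n f) else 0)" for f
    have lim: "(\<lambda>n. \<sigma> n f) \<longlonglongrightarrow> \<phi> f" if "f \<in> M" for f
      using conv[OF that] that by (simp add: \<phi>_def convergent_LIMSEQ_iff)
    have close': "\<exists>n0. \<forall>n\<ge>n0. \<forall>f\<in>M. \<bar>\<sigma> n f - \<phi> f\<bar> \<le> e * norm f" if e: "e > 0" for e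
    proof -
      obtain n0 where n0: "\<And>m n f. m \<ge> n0 \<Longrightarrow> n \<ge> n0 \<Longrightarrow> f \<in> M \<Longrightarrow> \<bar>\<sigma> n f - \<sigma> m f\<bar> \<le> e * norm f"
        using close[OF e] by blast
      \<comment> \<open>The other index of the Cauchy estimate tends to infinity while
        \<open>n\<close> stays fixed.\<close>
      have "\<bar>\<sigma> n f - \<phi> f\<bar> \<le> e * norm f" if "n \<ge> n0" "f \<in> M" for n f
      proof (rule LIMSEQ_le_const2)
        show "(\<lambda>m. \<bar>\<sigma> n f - \<sigma> m f\<bar>) \<longlonglongrightarrow> \<bar>\<sigma> n f - \<phi> f\<bar>"
          by (intro tendsto_intros lim that)
      qed (use n0 that in blast)
      then show ?thesis by blast
    qed
    have "linear_on_subspace M \<phi>"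
      unfolding linear_on_subspace_def
    proof (intro conjI ballI allI)
      fix f g assume fg: "f \<in> M" "g \<in> M"
      have "(\<lambda>n. \<sigma> n f + \<sigma> n g) \<longlonglongrightarrow> \<phi> f + \<phi> g" by (intro tendsto_add lim fg)
      then show "\<phi> (f + g) = \<phi> f + \<phi> g"
        using lim[OF subspace_add[OF M fg]] unfolding linear_on_subspaceD(1)[OF \<sigma>_lin fg]
        by (intro LIMSEQ_unique)
    next
      fix r f assume f: "f \<in> M"
      have "(\<lambda>n. r * \<sigma> n f) \<longlonglongrightarrow> r * \<phi> f" by (intro tendsto_mult_left lim f)
      then show "\<phi> (r *\<^sub>R f) = r * \<phi> f"
        using lim[OF subspace_scale[OF M f], of r] unfolding linear_on_subspaceD(2)[OF \<sigma>_lin f]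
        by (intro LIMSEQ_unique)
    qed
    moreover have "\<exists>K. \<forall>f\<in>M. \<bar>\<phi> f\<bar> \<le> K * norm f"
    proof -
      obtain n where n: "\<And>f. f \<in> M \<Longrightarrow> \<bar>\<sigma> n f - \<phi> f\<bar> \<le> 1 * norm f"
        using close'[of 1] by auto
      have "\<bar>\<phi> f\<bar> \<le> (N (\<sigma> n) + 1) * norm f" if "f \<in> M" for f
        using n[OF that] renorm_bound[OF \<sigma>(1) that, of n] by (simp add: distrib_right)
      then show ?thesis by blast
    qed
    ultimately have \<phi>: "\<phi> \<in> dual_on M" by (auto simp: dual_on_def \<phi>_def)
    have "(\<lambda>n. N (\<sigma> n - \<phi>)) \<longlonglongrightarrow> 0"
    proof (rule LIMSEQ_I)
      fix r :: real assume r: "0 < r"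
      have "r / (2 * C) > 0" using r C by simp
      from close'[OF this] obtain n0 where n0: "\<And>n f. n \<ge> n0 \<Longrightarrow> f \<in> M \<Longrightarrow> \<bar>\<sigma> n f - \<phi> f\<bar> \<le> r / (2 * C) * norm f"
        by blast
      have "norm (N (\<sigma> n - \<phi>) - 0) < r" if "n \<ge> n0" for n
      proof -
        have "N (\<sigma> n - \<phi>) \<le> C * (r / (2 * C))"
          using n0[OF that] r C by (intro renorm_le_dual) auto
        also have "\<dots> < r" using r C by simp
        finally show ?thesis using renorm_nonneg[OF sub[OF \<sigma>(1) \<phi>], of n] by simp
      qed
      then show "\<exists>n0. \<forall>n\<ge>n0. norm (N (\<sigma> n - \<phi>) - 0) < r" by blast
    qed
    then show "\<exists>l\<in>carr ?Z. (\<lambda>n. vdist ?Z (s n) l) \<longlonglongrightarrow> 0"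
      using \<phi> by (intro bexI[of _ "Inr \<phi>"]) (auto simp: \<sigma>(2) dist)
  qed
qed

lemma isometric_embedding_eval_on:
  "isometric_embedding (nspace_of UNIV) (renormed_dual M C) (\<lambda>x. Inr (eval_on M x))"
  unfolding isometric_embedding_def bounded_linear_map_def
  by (auto simp: eval_on_in_dual[OF M] eval_on_add eval_on_scale renorm_eval_on intro!: exI[of _ 1])

text \<open>Evaluation at \<open>f\<close> is the extension, and it preserves the norm:
  \<open>renorm_bound\<close> gives the upper estimate, testing on the isometric copy of
  \<open>X\<close> the lower one.\<close>

lemma boundedly_extendable_renormed_dual:
  "boundedly_extendable M (renormed_dual M C :: ('a, 'z) univ nspace) (\<lambda>x. Inr (eval_on M x))"
proof -
  let ?Z = "renormed_dual M C :: ('a, 'z) univ nspace"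
  interpret normed_nspace ?Z by (rule normed_nspace_renormed_dual)
  define \<pi> where "\<pi> f = (\<lambda>z\<in>carr ?Z. projr z f)" for f
  have \<pi>_bound: "\<bar>\<pi> f z\<bar> \<le> norm f * vnorm ?Z z" if "f \<in> M" "z \<in> carr ?Z" for f z
    using that renorm_bound by (auto simp: \<pi>_def mult.commute)
  have \<pi>_dual: "\<pi> f \<in> carr (dual_nspace ?Z)" if f: "f \<in> M" for f
    by (rule mem_dualI[OF _ _ _ \<pi>_bound[OF f]])
      (auto simp: \<pi>_def extensional_def Inr_in_image_Inr dual_on_add dual_on_scale)
  have lower: "norm f \<le> vnorm (dual_nspace ?Z) (\<pi> f)" if f: "f \<in> M" for f
  proof (rule norm_blinfun_bound[OF dual_norm_nonneg[OF \<pi>_dual[OF f]]])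
    fix x
    have x: "Inr (eval_on M x) \<in> carr ?Z" using eval_on_in_dual[OF M] by simp
    show "norm (f x) \<le> vnorm (dual_nspace ?Z) (\<pi> f) * norm x"
      using dual_norm_bound[OF \<pi>_dual[OF f] x] x f
      by (simp add: \<pi>_def renorm_eval_on) (simp add: eval_on_def)
  qed
  have lin: "\<phi> (f + g) = \<phi> f + \<phi> g" "\<phi> (r *\<^sub>R f) = r * \<phi> f" if "\<phi> \<in> dual_on M" "f \<in> M" "g \<in> M" for \<phi> f g r
    using that by (auto simp: dual_on_def linear_on_subspace_def)
  have "bounded_linear_map (nspace_of M) (dual_nspace ?Z) \<pi>"
    unfolding bounded_linear_map_def nspace_of_simps
  proof (intro conjI ballI allI exI[of _ 1])
    show "\<pi> \<in> M \<rightarrow> carr (dual_nspace ?Z)" using \<pi>_dual by blast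
    show "\<pi> (f + g) = vadd (dual_nspace ?Z) (\<pi> f) (\<pi> g)" if "f \<in> M" "g \<in> M" for f g
      using lin that by (auto simp: \<pi>_def dual_nspace_ops restrict_def fun_eq_iff)
    show "\<pi> (r *\<^sub>R f) = vscale (dual_nspace ?Z) r (\<pi> f)" if "f \<in> M" for f r
      using lin(2)[OF _ that that] by (auto simp: \<pi>_def dual_nspace_ops restrict_def fun_eq_iff)
    show "vnorm (dual_nspace ?Z) (\<pi> f) \<le> 1 * norm f" if "f \<in> M" for f
      using \<pi>_bound[OF that] by (intro dual_norm_le) auto
  qed
  then have "isomorphic_embedding (nspace_of M) (dual_nspace ?Z) \<pi>"
    using lower by (auto simp: isomorphic_embedding_def intro!: exI[of _ 1])
  moreover have "\<pi> f (Inr (eval_on M x)) = f x" if "f \<in> M" for f x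
    using that eval_on_in_dual[OF M, of x] by (simp add: \<pi>_def) (simp add: eval_on_def)
  ultimately show ?thesis unfolding boundedly_extendable_def by blast
qed

section \<open>Extending functionals from \<open>X\<close> and using a projection onto the
  annihilator\<close>

lemma extension_exists:
  fixes f :: "'a \<Rightarrow>\<^sub>L real"
  shows "\<exists>L. linear_on_subspace (dual_on M) L \<and> (\<forall>\<phi>\<in>dual_on M. \<bar>L \<phi>\<bar> \<le> norm f * N \<phi>) \<and>
    (\<forall>x. L (eval_on M x) = f x)"
proof -
  define h where "h \<phi> = f (inv (eval_on M) \<phi>)" for \<phi>
  have "inj (eval_on M)"
  proof (rule injI)
    fix x y assume "eval_on M x = eval_on M y"
    then have "eval_on M (x + (- 1) *\<^sub>R y) = 0" unfolding eval_on_add eval_on_scale by simp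
    then show "x = y"
      using renorm_eval_on[of "x - y"] renorm_eq_zero[OF dual_on_zero] by simp
  qed
  then have h: "h (eval_on M x) = f x" for x by (simp add: h_def)
  \<comment> \<open>Since \<open>X\<close> embeds isometrically, \<open>norm f * N\<close> dominates
    \<open>f\<close> on its image, so the extension keeps the norm of \<open>f\<close>.\<close>
  interpret minorised_cone "dual_on M" "range (eval_on M)" "\<lambda>\<phi>. norm f * N \<phi>" h
  proof
    show "subspace (dual_on M)" by (rule subspace_dual_on)
    show "sublinear_on (dual_on M) (\<lambda>\<phi>. norm f * N \<phi>)"
    proof (rule sublinear_onI[OF subspace_dual_on])
      show "norm f * N (\<phi> + \<psi>) \<le> norm f * N \<phi> + norm f * N \<psi>"
        if "\<phi> \<in> dual_on M" "\<psi> \<in> dual_on M" for \<phi> \<psi>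
        using mult_left_mono[OF renorm_triangle[OF that] norm_ge_zero[of f]] by (simp add: distrib_left)
    qed (auto simp: renorm_scale renorm_eq_zero dual_on_zero)
    show "range (eval_on M) \<subseteq> dual_on M" using eval_on_in_dual[OF M] by auto
    show "0 \<in> range (eval_on M)" using eval_on_scale[of M 0 0] by (metis rangeI scale_zero_left)
    show "\<phi> + \<psi> \<in> range (eval_on M)" if "\<phi> \<in> range (eval_on M)" "\<psi> \<in> range (eval_on M)" for \<phi> \<psi>
      using that by (auto simp flip: eval_on_add)
    show "r *\<^sub>R \<phi> \<in> range (eval_on M)" if "\<phi> \<in> range (eval_on M)" for r \<phi>
      using that by (auto simp flip: eval_on_scale)
    show "h (\<phi> + \<psi>) = h \<phi> + h \<psi>" if "\<phi> \<in> range (eval_on M)" "\<psi> \<in> range (eval_on M)" for \<phi> \<psi>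
      using that by (auto simp: h blinfun.bilinear_simps simp flip: eval_on_add)
    show "h (r *\<^sub>R \<phi>) = r * h \<phi>" if "\<phi> \<in> range (eval_on M)" for r \<phi>
      using that by (auto simp: h blinfun.bilinear_simps simp flip: eval_on_scale)
    show "h \<phi> \<le> norm f * N \<phi>" if \<phi>: "\<phi> \<in> range (eval_on M)" for \<phi>
    proof -
      obtain x where "\<phi> = eval_on M x" using \<phi> by blast
      then show ?thesis using norm_blinfun[of f x] by (simp add: h renorm_eval_on)
    qed
  qed
  obtain L where L: "linear_on_subspace (dual_on M) L" "\<And>\<phi>. \<phi> \<in> dual_on M \<Longrightarrow> L \<phi> \<le> norm f * N \<phi>"
    and ge: "\<And>x. f x \<le> L (eval_on M x)"
    using Mazur_Orlicz h by (metis rangeI)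
  have L_neg: "L ((-1) *\<^sub>R \<phi>) = - L \<phi>" if "\<phi> \<in> dual_on M" for \<phi>
    using linear_on_subspaceD(2)[OF L(1) that, of "-1"] by simp
  \<comment> \<open>Mazur-Orlicz provides one inequality on the image of \<open>X\<close>; as the
    image is a subspace, \<open>- x\<close> provides the other.\<close>
  have "L (eval_on M x) = f x" for x
    using ge[of x] ge[of "(-1) *\<^sub>R x"] L_neg[OF eval_on_in_dual[OF M], of x]
    unfolding eval_on_scale by (simp add: blinfun.bilinear_simps)
  moreover have "\<bar>L \<phi>\<bar> \<le> norm f * N \<phi>" if "\<phi> \<in> dual_on M" for \<phi>
    using L(2)[OF that] L(2)[OF dual_on_scale[OF that, of "-1"]]
      L_neg[OF that] renorm_scale[OF that, of "-1"] by (simp add: abs_le_iff)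
  ultimately show ?thesis using L(1) by blast
qed

text \<open>The extensions \<open>F f\<close> are chosen separately and need not be linear in
  \<open>f\<close>. But \<open>E f\<close> is independent of the choice: two extensions of
  \<open>f\<close> differ by an element of the annihilator, which \<open>P\<close> fixes. Linearity
  follows, because sums and multiples of extensions are extensions.\<close>

lemma bidual_lifting_of_projection:
  fixes Z :: "('a, 'z) univ nspace"
  defines "Z \<equiv> renormed_dual M C"
  assumes "complemented_in (annihilator Z (range (\<lambda>x. Inr (eval_on M x)))) (dual_nspace Z)"
  shows "\<exists>D e. bidual_lifting M D e"
proof -
  interpret normed_nspace Z unfolding Z_def by (rule normed_nspace_renormed_dual)
  let ?D = "dual_nspace Z" and ?J = "\<lambda>x. Inr (eval_on M x) :: ('a, 'z) univ"
  have carrZ: "carr Z = Inr ` dual_on M" by (simp add: Z_def)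
  obtain P where P: "bounded_linear_map ?D ?D P" and P_img: "P ` carr ?D = annihilator Z (range ?J)"
    and P_id: "\<And>\<phi>. \<phi> \<in> annihilator Z (range ?J) \<Longrightarrow> P \<phi> = \<phi>"
    using assms(2) unfolding complemented_in_def by blast
  have P_dual: "P \<phi> \<in> carr ?D" if "\<phi> \<in> carr ?D" for \<phi>
    using P that by (auto simp: bounded_linear_map_def)
  have P_add: "P (vadd ?D \<phi> \<psi>) z = P \<phi> z + P \<psi> z" if "\<phi> \<in> carr ?D" "\<psi> \<in> carr ?D" "z \<in> carr Z" for \<phi> \<psi> z
    using P that by (simp add: bounded_linear_map_def dual_nspace_ops)
  have P_scale: "P (vscale ?D r \<phi>) z = r * P \<phi> z" if "\<phi> \<in> carr ?D" "z \<in> carr Z" for r \<phi> z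
    using P that by (simp add: bounded_linear_map_def dual_nspace_ops)
  obtain K0 where K0: "\<And>\<phi>. \<phi> \<in> carr ?D \<Longrightarrow> vnorm ?D (P \<phi>) \<le> K0 * vnorm ?D \<phi>"
    using P unfolding bounded_linear_map_def by blast
  define KP where "KP = max K0 0"
  have KP0: "0 \<le> KP" by (simp add: KP_def)
  have KP: "vnorm ?D (P \<phi>) \<le> KP * vnorm ?D \<phi>" if "\<phi> \<in> carr ?D" for \<phi>
    using K0[OF that] mult_right_mono[of K0 KP, OF _ dual_norm_nonneg[OF that]] by (simp add: KP_def)
  obtain L where L: "\<And>f. linear_on_subspace (dual_on M) (L f)"
    "\<And>f \<phi>. \<phi> \<in> dual_on M \<Longrightarrow> \<bar>L f \<phi>\<bar> \<le> norm f * N \<phi>" "\<And>f x. L f (eval_on M x) = blinfun_apply f x"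
    using extension_exists by metis
  define F where "F f = (\<lambda>z\<in>carr Z. L f (projr z))" for f
  have F_bound: "\<bar>F f z\<bar> \<le> norm f * vnorm Z z" if "z \<in> carr Z" for f z
    using that L(2) by (auto simp: F_def Z_def)
  have F_dual: "F f \<in> carr ?D" for f
  proof (rule mem_dualI[OF _ _ _ F_bound])
    show "F f \<in> extensional (carr Z)" by (simp add: F_def extensional_def)
    show "F f (vadd Z z w) = F f z + F f w" if "z \<in> carr Z" "w \<in> carr Z" for z w
      using that add_in[OF that] linear_on_subspaceD(1)[OF L(1)] by (auto simp: F_def Z_def)
    show "F f (vscale Z r z) = r * F f z" if "z \<in> carr Z" for r z
      using that scale_in[OF that] linear_on_subspaceD(2)[OF L(1)] by (auto simp: F_def Z_def)
  qed
  have JZ: "?J x \<in> carr Z" for x using eval_on_in_dual[OF M] by (simp add: carrZ)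
  have F_J: "F f (?J x) = f x" for f x using JZ[of x] by (simp add: F_def L(3))
  have P_J: "P \<phi> (?J x) = 0" if "\<phi> \<in> carr ?D" for \<phi> x
    using that P_img by (auto simp: annihilator_def)
  have F_norm: "vnorm ?D (F f) \<le> norm f" for f
    using F_bound by (intro dual_norm_le) auto
  define E where "E f z = F f z - P (F f) z" for f z
  have E_unique: "E f z = \<phi> z - P \<phi> z"
    if \<phi>: "\<phi> \<in> carr ?D" and J: "\<And>x. \<phi> (?J x) = blinfun_apply f x" and z: "z \<in> carr Z" for f \<phi> z
  proof -
    let ?d = "vadd ?D \<phi> (vscale ?D (-1) (F f))"
    have d: "?d \<in> carr ?D" by (intro dual_add_in dual_scale_in \<phi> F_dual)
    have "?d \<in> annihilator Z (range ?J)"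
      using d JZ by (auto simp: annihilator_def) (simp add: dual_nspace_ops J F_J)
    then have "P ?d z = ?d z" using P_id by simp
    moreover have "P ?d z = P \<phi> z - P (F f) z"
      using P_add[OF \<phi> dual_scale_in[OF F_dual] z] P_scale[OF F_dual z] by simp
    moreover have "?d z = \<phi> z - F f z" using z by (simp add: dual_nspace_ops)
    ultimately show ?thesis by (simp add: E_def)
  qed
  have E_bound: "\<bar>E f z\<bar> \<le> (1 + KP) * norm f * vnorm Z z" if z: "z \<in> carr Z" for f z
  proof -
    have "vnorm ?D (P (F f)) \<le> KP * norm f"
      using KP[OF F_dual, of f] mult_left_mono[OF F_norm KP0, of f] by simp
    then have "\<bar>P (F f) z\<bar> \<le> KP * norm f * vnorm Z z"
      using dual_norm_bound[OF P_dual[OF F_dual] z, of f] norm_nonneg[OF z]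
        mult_right_mono order_trans by blast
    then show ?thesis using F_bound[OF z, of f] by (simp add: E_def algebra_simps)
  qed
  \<comment> \<open>\<open>1 + KP\<close> is the cost of passing from \<open>F f\<close> to
    \<open>F f - P (F f)\<close>; \<open>C\<close> compares \<open>renorm\<close> with the dual norm
    in which \<open>bidual_lifting\<close> is phrased.\<close>
  have "bidual_lifting M ((1 + KP) * C) (\<lambda>f \<phi>. E f (Inr \<phi>))"
  proof
    show "subspace M" by (rule M)
    show "0 \<le> (1 + KP) * C" using KP0 C by simp
    show "linear_on_subspace (dual_on M) (\<lambda>\<phi>. E f (Inr \<phi>))" for f
    proof -
      have "\<phi> (Inr (a + b)) = \<phi> (Inr a) + \<phi> (Inr b)" if "\<phi> \<in> carr ?D" "a \<in> dual_on M" "b \<in> dual_on M" for \<phi> a b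
        using dual_memD(2)[OF that(1), of "Inr a" "Inr b"] that by (simp add: carrZ) (simp add: Z_def)
      moreover have "\<phi> (Inr (r *\<^sub>R a)) = r * \<phi> (Inr a)" if "\<phi> \<in> carr ?D" "a \<in> dual_on M" for \<phi> a r
        using dual_memD(3)[OF that(1), of "Inr a" r] that by (simp add: carrZ) (simp add: Z_def)
      ultimately show ?thesis
        using F_dual P_dual by (simp add: linear_on_subspace_def E_def algebra_simps)
    qed
    fix \<psi> assume \<psi>: "\<psi> \<in> dual_on M"
    then have z: "Inr \<psi> \<in> carr Z" by (simp add: carrZ)
    show "E (f + g) (Inr \<psi>) = E f (Inr \<psi>) + E g (Inr \<psi>)" for f g
    proof -
      have "vadd ?D (F f) (F g) (?J x) = (f + g) x" for x
        using JZ[of x] by (simp add: dual_nspace_ops F_J blinfun.bilinear_simps)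
      from E_unique[OF dual_add_in[OF F_dual F_dual] this z] show ?thesis
        using P_add[OF F_dual F_dual z] z by (simp add: E_def) (simp add: dual_nspace_ops)
    qed
    show "E (r *\<^sub>R f) (Inr \<psi>) = r * E f (Inr \<psi>)" for r f
    proof -
      have "vscale ?D r (F f) (?J x) = (r *\<^sub>R f) x" for x
        using JZ[of x] by (simp add: dual_nspace_ops F_J blinfun.bilinear_simps)
      from E_unique[OF dual_scale_in[OF F_dual] this z] show ?thesis
        using P_scale[OF F_dual z] z by (simp add: E_def) (simp add: dual_nspace_ops algebra_simps)
    qed
    fix K :: real assume K: "0 \<le> K" "\<And>g. g \<in> M \<Longrightarrow> \<bar>\<psi> g\<bar> \<le> K * norm g"
    show "\<bar>E f (Inr \<psi>)\<bar> \<le> (1 + KP) * C * norm f * K" for f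
    proof -
      have "vnorm Z (Inr \<psi>) \<le> C * K" using renorm_le_dual[OF K] by (simp add: Z_def)
      then have "(1 + KP) * norm f * vnorm Z (Inr \<psi>) \<le> (1 + KP) * norm f * (C * K)"
        using KP0 by (intro mult_left_mono) auto
      then show ?thesis using E_bound[OF z, of f] by (simp add: algebra_simps)
    qed
  next
    show "E f (Inr (eval_on M x)) = f x" for f x
      using P_J[OF F_dual] F_J by (simp add: E_def)
  qed
  then show ?thesis by blast
qed

end

theorem theorem6:
  assumes "separable_space (euclidean :: 'a::banach topology)"
    and "BAP TYPE('a)"
  shows "\<not> TPBA TYPE('a) \<longleftrightarrow>
    (\<exists>(Z :: ('a, 'z) univ nspace) (J :: 'a \<Rightarrow> ('a, 'z) univ).
       banach_nspace Z \<and>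
       isometric_embedding (nspace_of UNIV) Z J \<and>
       \<not> complemented_in (annihilator Z (range J)) (dual_nspace Z) \<and>
       (\<exists>M :: ('a \<Rightarrow>\<^sub>L real) set. subspace M \<and> norming M \<and> boundedly_extendable M Z J))"
    (is "_ \<longleftrightarrow> ?R")
proof
  assume "\<not> TPBA TYPE('a)"
  then obtain M :: "('a \<Rightarrow>\<^sub>L real) set" where qb: "subspace M" "norming M" "\<not> quasibasic M"
    by (auto simp: TPBA_def)
  then obtain c where c: "0 < c" "\<And>x. c * norm x \<le> (SUP f\<in>M. \<bar>blinfun_apply f x\<bar> / norm f)"
    unfolding norming_def by blast
  \<comment> \<open>\<open>1 + 1 / c\<close> is at least 1 and at least \<open>1 / c\<close>, the
    two lower bounds imposed on \<open>C\<close>.\<close>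
  interpret norming_subspace M c "1 + 1 / c"
    using qb(1) c by unfold_locales auto
  have "\<not> complemented_in (annihilator (renormed_dual M (1 + 1 / c) :: ('a, 'z) univ nspace)
      (range (\<lambda>x. Inr (eval_on M x)))) (dual_nspace (renormed_dual M (1 + 1 / c)))"
    using bidual_lifting_of_projection bidual_lifting.quasibasic[OF _ assms] qb(3) by blast
  then show ?R
    using banach_nspace_renormed_dual isometric_embedding_eval_on boundedly_extendable_renormed_dual qb(1,2)
    by blast
next
  assume ?R
  then obtain Z :: "('a, 'z) univ nspace" and J and M :: "('a \<Rightarrow>\<^sub>L real) set" where
    Z: "normed_nspace Z" "isometric_embedding (nspace_of UNIV) Z J"
    "\<not> complemented_in (annihilator Z (range J)) (dual_nspace Z)"
    and M: "subspace M" "norming M" "boundedly_extendable M Z J"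
    by (auto simp: banach_nspace_def)
  then have "\<not> quasibasic M"
    using quasibasic_imp_complemented_annihilator by blast
  then show "\<not> TPBA TYPE('a)" using M by (auto simp: TPBA_def)
qed

end
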